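(* For every positive integer $k$ there exist constants $D_k\geq1$ and $B_k>0$, depending only on $k$, such that the following holds. For every positive integer $d$, every system $h_1,\dots,h_d$ of polynomials of degree at most $k$ with real coefficients and no constant term (i.e. $h_j(0)=0$), and every integer $N\geq1$, there exists an integer $1\leq n\leq N$ such that \[\|h_j(n)\|\leq B_k \exp\bigl(-(4^k k!\,D_k d^{5k})^{-1}(\log N)^{1/D_k}\bigr)\quad\text{for } j=1,\dots,d.\]
   Context: For $\alpha\in\mathbb R$, $\|\alpha\|$ denotes the distance from $\alpha$ to the nearest integer. *)

theory Defs
  imports "HOL-Analysis.Analysis" "HOL-Computational_Algebra.Polynomial"
begin

definition dist_nearest_int :: "real \<Rightarrow> real" where
  "dist_nearest_int x = (INF m\<in>(\<int>::real set). \<bar>x - m\<bar>)"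

end

theory Submission
  imports Defs
begin

text \<open>
  The degree is lowered one step at a time: choose \<open>n\<^sub>1\<close> making the leading terms extremely close to
  integers and then \<open>n = n\<^sub>1 n\<^sub>2\<close> with \<open>n\<^sub>2\<close> much smaller, so that only polynomials of lower degree in
  \<open>n\<^sub>2\<close> remain. It therefore suffices to treat the monomials \<open>\<alpha>\<^sub>j n\<^sup>k\<close>, with \<open>ln N\<close> polynomial in \<open>d\<close> and
  \<open>ln (1/\<delta>)\<close>.

  For monomials, average the kernel \<open>\<Prod>\<^sub>j cos (\<pi> x\<^sub>j)^(2m)\<close>, whose Fourier coefficients are nonnegative,
  along the orbit. If no \<open>n \<le> N\<close> works, some frequency \<open>\<xi>\<close> has a large Weyl sum, so \<open>\<xi> \<cdot> \<alpha>\<close> is very close to a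
  rational with small denominator \<open>q\<close>; replacing \<open>\<alpha>\<close> by \<open>q\<^sup>k \<alpha>\<close> and shortening the range makes \<open>\<xi>\<close>
  harmless, because its exponentials now have nonnegative real part. All signed sums (coefficients in
  \<open>{-1, 0, 1}\<close>) of the frequencies found so far are then harmless too, so the next frequency is not one
  of them. Hence the subset sums of the frequencies found are pairwise distinct points of a box, and
  after \<open>L\<close> steps \<open>2\<^sup>L \<le> (2 L m + 1)\<^sup>d\<close>, which bounds the number of steps polynomially. Each step costs only
  a bounded factor of \<open>N\<close>.
\<close>

subsection \<open>Distance to the nearest integer\<close>

text \<open>The infimum is attained at \<open>round x\<close>; this is the form the later proofs
  compute with.\<close>

lemma dist_nearest_int_eq: "dist_nearest_int x = \<bar>x - of_int (round x)\<bar>"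
proof -
  have "(INF m\<in>(\<int>::real set). \<bar>x - m\<bar>) = \<bar>x - of_int (round x)\<bar>"
    using round_diff_minimal[of x] by (intro cInf_eq_minimum) (auto elim!: Ints_cases)
  thus ?thesis by (simp add: dist_nearest_int_def)
qed

lemma dist_nearest_int_le: "dist_nearest_int x \<le> \<bar>x - of_int m\<bar>"
  unfolding dist_nearest_int_eq by (rule round_diff_minimal)

lemma dist_nearest_int_le_half: "dist_nearest_int x \<le> 1 / 2"
  unfolding dist_nearest_int_eq using of_int_round_abs_le[of x] by linarith

lemma dist_nearest_int_nonneg: "0 \<le> dist_nearest_int x"
  unfolding dist_nearest_int_eq by simp

lemma dist_nearest_int_add: "dist_nearest_int (x + y) \<le> dist_nearest_int x + dist_nearest_int y"
  using dist_nearest_int_le[of "x + y" "round x + round y"] unfolding dist_nearest_int_eq of_int_add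
  by linarith

lemma dist_nearest_int_mult_int:
  "dist_nearest_int (of_int a * x) \<le> \<bar>of_int a\<bar> * dist_nearest_int x"
proof -
  have "dist_nearest_int (of_int a * x) \<le> \<bar>of_int a * x - of_int (a * round x)\<bar>"
    by (rule dist_nearest_int_le)
  also have "\<dots> = \<bar>of_int a\<bar> * dist_nearest_int x"
    unfolding dist_nearest_int_eq by (simp flip: abs_mult add: algebra_simps)
  finally show ?thesis .
qed

lemma dist_nearest_int_mult_nat: "dist_nearest_int (real a * x) \<le> real a * dist_nearest_int x"
  using dist_nearest_int_mult_int[of "int a" x] by simp

lemma dist_nearest_int_diff: "dist_nearest_int (x - y) \<le> dist_nearest_int x + dist_nearest_int y"
  using dist_nearest_int_add[of x "- y"] dist_nearest_int_mult_int[of "-1" y] by simp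

lemma dist_nearest_int_sum:
  "dist_nearest_int (\<Sum>i\<in>I. f i) \<le> (\<Sum>i\<in>I. dist_nearest_int (f i))"
proof (induction I rule: infinite_finite_induct)
  case (insert i I)
  thus ?case using dist_nearest_int_add[of "f i" "sum f I"] by simp
qed (use dist_nearest_int_le[of 0 0] in auto)

text \<open>Jordan's inequality: sine is concave on [0, pi], so on [0, pi / 2] it lies above its
  chord.\<close>

lemma sin_pi_times_ge:
  fixes x :: real
  assumes "0 \<le> x" "x \<le> 1 / 2"
  shows "2 * x \<le> sin (pi * x)"
proof -
  have "convex_on {0..pi} (\<lambda>x. - sin x)"
  proof (rule f''_ge0_imp_convex)
    show "((\<lambda>x. - sin x) has_real_derivative (- cos x)) (at x)" for x :: real
      by (auto intro!: derivative_eq_intros)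
    show "((\<lambda>x. - cos x) has_real_derivative (sin x)) (at x)" for x :: real
      by (auto intro!: derivative_eq_intros)
  qed (auto intro: sin_ge_zero)
  from convex_onD[OF this, of "2 * x" 0 "pi / 2"] assms show ?thesis
    by (simp add: mult.commute)
qed

text \<open>The absolute value of \<open>sin (pi * x)\<close> is even in \<open>x\<close> and has
  period 1, so \<open>x\<close> may be replaced by its distance to the nearest integer, where
  Jordan's inequality applies.\<close>

lemma abs_sin_pi_ge: "2 * dist_nearest_int x \<le> \<bar>sin (pi * x)\<bar>"
proof -
  define y where "y = x - of_int (round x)"
  have "\<bar>sin (pi * x)\<bar> = \<bar>sin (pi * y + of_int (round x) * pi)\<bar>"
    by (simp add: y_def algebra_simps)
  also have "\<dots> = \<bar>sin (pi * y)\<bar>"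
    proof -
    have "sin (of_int (round x) * pi) = 0" by (simp add: sin_times_pi_eq_0)
    moreover from this have "\<bar>cos (of_int (round x) * pi)\<bar> = 1"
      using sin_cos_squared_add[of "of_int (round x) * pi"] by (auto simp: power2_eq_1_iff)
    ultimately show ?thesis by (simp only: sin_add abs_mult mult_zero_right add_0_right mult_1_right)
  qed
  also have "\<dots> = \<bar>sin (pi * \<bar>y\<bar>)\<bar>"
    by (cases "y \<ge> 0") auto
  finally have "\<bar>sin (pi * x)\<bar> = \<bar>sin (pi * \<bar>y\<bar>)\<bar>" .
  moreover have "\<bar>y\<bar> = dist_nearest_int x" by (simp add: y_def dist_nearest_int_eq)
  ultimately show ?thesis
    using sin_pi_times_ge[of "dist_nearest_int x"] dist_nearest_int_le_half[of x]
      dist_nearest_int_nonneg[of x] by simp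
qed

text \<open>The chord on the left of the unit circle has length
  \<open>2 * \<bar>sin (pi * x)\<bar>\<close>. It is the denominator in the geometric sums of the
  linear case.\<close>

lemma norm_one_minus_cis_ge: "4 * dist_nearest_int x \<le> norm (1 - cis (2 * pi * x))"
proof -
  have "(norm (1 - cis (2 * pi * x)))\<^sup>2 = (2 * \<bar>sin (pi * x)\<bar>)\<^sup>2"
    using cos_double_sin[of "pi * x"] sin_cos_squared_add[of "2 * pi * x"]
    by (simp add: cmod_power2 power2_diff power_mult_distrib mult.assoc)
  hence "norm (1 - cis (2 * pi * x)) = 2 * \<bar>sin (pi * x)\<bar>"
    by (subst (asm) power2_eq_iff_nonneg) auto
  thus ?thesis using abs_sin_pi_ge[of x] by simp
qed

text \<open>Supplies the sign condition for harmless frequencies: reduced modulo 1, the angle stays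
  within a quarter turn.\<close>

lemma cos_two_pi_nonneg:
  assumes "dist_nearest_int x \<le> 1 / 4"
  shows "0 \<le> cos (2 * pi * x)"
proof -
  define y where "y = x - of_int (round x)"
  have y: "\<bar>y\<bar> \<le> 1 / 4" using assms by (simp add: y_def dist_nearest_int_eq)
  have "cos (2 * pi * x) = cos (2 * pi * y + 2 * pi * of_int (round x))"
    by (simp add: y_def algebra_simps)
  also have "\<dots> = cos (2 * pi * y)" by (simp add: cos_add)
  also have "\<dots> \<ge> 0"
  proof (rule cos_ge_zero)
    have "pi * \<bar>y\<bar> \<le> pi * (1 / 4)" using y by (intro mult_left_mono) auto
    hence "\<bar>2 * pi * y\<bar> \<le> pi / 2" by (simp add: abs_mult)
    thus "- (pi / 2) \<le> 2 * pi * y" "2 * pi * y \<le> pi / 2" by linarith+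
  qed
  finally show ?thesis .
qed

subsection \<open>Integers with many small multiples\<close>

text \<open>Pigeonhole: \<open>H\<close> has at least \<open>N / Y\<close> elements, spread over at
  most \<open>N / w + 1 \<le> 2 * N / w\<close> windows. The factor 2 pays for the incomplete last
  window.\<close>

lemma ex_heavy_window:
  fixes H :: "nat set"
  assumes H: "H \<subseteq> {..<N}" and w: "1 \<le> w" "w \<le> N" and card: "real N \<le> Y * real (card H)"
    and Y: "Y > 0"
  shows "\<exists>j. real w \<le> 2 * Y * real (card {h \<in> H. h div w = j})"
proof (rule ccontr)
  assume "\<not> ?thesis"
  hence *: "real (card {h \<in> H. h div w = j}) < real w / (2 * Y)" for j
    using Y by (auto simp: field_simps not_le)
  have fin: "finite H" using H finite_subset by blast
  have "(\<lambda>h. h div w) ` H \<subseteq> {..N div w}"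
    using H by (auto intro!: div_le_mono)
  hence "card H = (\<Sum>j\<le>N div w. card {h \<in> H. h div w = j})"
    using card_eq_sum[of H] sum.group[of H "{..N div w}" "\<lambda>h. h div w" "\<lambda>_. 1::nat"] fin by simp
  hence "real (card H) = (\<Sum>j\<le>N div w. real (card {h \<in> H. h div w = j}))" by simp
  also have "\<dots> < (\<Sum>j\<le>N div w. real w / (2 * Y))"
    by (intro sum_strict_mono *) auto
  also have "\<dots> = real (N div w + 1) * real w / (2 * Y)" by simp
  also have "\<dots> \<le> 2 * real N / (2 * Y)"
  proof -
    have "(N div w + 1) * w \<le> 2 * N" using w by (simp add: algebra_simps) (metis add_mono mult.commute times_div_less_eq_dividend mult_2)
    hence "real (N div w + 1) * real w \<le> 2 * real N"
      by (metis of_nat_le_iff of_nat_mult of_nat_numeral)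
    thus ?thesis using Y by (intro divide_right_mono) auto
  qed
  finally have "Y * real (card H) < real N" using Y by (simp add: field_simps)
  thus False using card by simp
qed

text \<open>The interval from \<open>Min A\<close> to \<open>Max A\<close> contains
  \<open>A\<close>, so it has at least \<open>card A\<close> points.\<close>

lemma ex_spread_pair:
  fixes A :: "nat set"
  assumes "finite A" "A \<noteq> {}"
  shows "\<exists>a\<in>A. \<exists>b\<in>A. a + card A \<le> b + 1"
proof -
  have "A \<subseteq> {Min A..Max A}" using assms by auto
  hence "card A \<le> card {Min A..Max A}" by (intro card_mono) auto
  moreover have "Min A \<le> Max A" using assms by simp
  ultimately have "Min A + card A \<le> Max A + 1" by simp
  thus ?thesis using assms Min_in Max_in by blast
qed

text \<open>Differences of elements of \<open>H\<close> move \<open>\<gamma>\<close> to within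
  \<open>2 * \<epsilon>\<close> of an integer. A short window supplies a small difference
  \<open>q\<close>, long windows supply large differences \<open>t\<close>. Since two different
  fractions with denominators \<open>q\<close> and \<open>t\<close> cannot be too close, the error
  of \<open>q\<close> times \<open>t\<close> is still of order \<open>\<epsilon> * q\<close>, which
  saves the factor \<open>N\<close>. The witness is \<open>q\<close>.\<close>

lemma ex_small_multiplier_of_many_small:
  fixes H :: "nat set" and Y \<epsilon> \<gamma> :: real
  assumes H: "H \<subseteq> {..<N}" and card: "real N \<le> Y * real (card H)" and Y: "Y \<ge> 2"
    and N: "real N \<ge> 5 * Y" and eps: "0 < \<epsilon>" "\<epsilon> * (200 * Y ^ 2) \<le> 1"
    and small: "\<And>h. h \<in> H \<Longrightarrow> dist_nearest_int (real h * \<gamma>) \<le> \<epsilon>"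
  shows "\<exists>t\<ge>1. real t \<le> 5 * Y \<and> dist_nearest_int (real t * \<gamma>) * real N \<le> 40 * \<epsilon> * Y ^ 2"
proof -
  have fin: "finite H" using H finite_subset by blast
  \<comment> \<open>\<open>t\<close> is the difference of two far apart elements of a heavy window;
    its lower bound comes from the number of elements in that window.\<close>
  have pair: "\<exists>t. real w / (2 * Y) - 1 \<le> real t \<and> t < w \<and> dist_nearest_int (real t * \<gamma>) \<le> 2 * \<epsilon>"
    if w: "1 \<le> w" "w \<le> N" for w
  proof -
    obtain j where j: "real w \<le> 2 * Y * real (card {h \<in> H. h div w = j})"
      using ex_heavy_window[OF H w card] Y by auto
    define A where "A = {h \<in> H. h div w = j}"
    have "A \<noteq> {}" using j w unfolding A_def[symmetric] by auto
    moreover have "finite A" using fin by (simp add: A_def)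
    ultimately obtain a b where ab: "a \<in> A" "b \<in> A" "a + card A \<le> b + 1"
      using ex_spread_pair by blast
    have "card A \<ge> 1" using \<open>A \<noteq> {}\<close> \<open>finite A\<close> by (simp add: Suc_leI card_gt_0_iff)
    hence le: "a \<le> b" using ab by simp
    have "b - a < w"
    proof -
      have "a div w = b div w" using ab by (auto simp: A_def)
      moreover have "b = w * (b div w) + b mod w" "a = w * (a div w) + a mod w" by simp_all
      moreover have "b mod w < w" using w by simp
      ultimately show ?thesis by (metis add_diff_cancel_left less_imp_diff_less)
    qed
    moreover have "real w / (2 * Y) \<le> real (card A)" using j Y by (simp add: A_def field_simps)
    hence "real w / (2 * Y) - 1 \<le> real (b - a)" using ab le by (simp add: of_nat_diff)
    moreover have "dist_nearest_int (real (b - a) * \<gamma>) \<le> 2 * \<epsilon>"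
      using dist_nearest_int_diff[of "real b * \<gamma>" "real a * \<gamma>"] small[of a] small[of b] ab le
      by (auto simp: A_def of_nat_diff algebra_simps)
    ultimately show ?thesis by blast
  qed
  have Y2: "Y ^ 2 \<ge> 2 * Y" using Y by (simp add: power2_eq_square)
  \<comment> \<open>This width makes \<open>w / (2 * Y) - 1\<close> at least 1, so that
    \<open>q\<close> is nonzero, while \<open>q < w\<close> keeps it at most
    \<open>5 * Y\<close>.\<close>
  define w where "w = nat \<lceil>4 * Y\<rceil>"
  have w: "real w \<ge> 4 * Y" "real w < 4 * Y + 1" using Y unfolding w_def by linarith+
  obtain q where q: "real w / (2 * Y) - 1 \<le> real q" "q < w" "dist_nearest_int (real q * \<gamma>) \<le> 2 * \<epsilon>"
    using pair[of w] w Y N by auto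
  have "real w / (2 * Y) \<ge> 2" using w Y by (simp add: field_simps)
  hence q1: "q \<ge> 1" using q by linarith
  have q5: "real q \<le> 5 * Y" using q w Y by linarith
  define a where "a = round (real q * \<gamma>)"
  define \<theta> where "\<theta> = real q * \<gamma> - of_int a"
  have \<theta>: "\<bar>\<theta>\<bar> = dist_nearest_int (real q * \<gamma>)" by (simp add: \<theta>_def a_def dist_nearest_int_eq)
  \<comment> \<open>\<open>t \<theta> - q \<phi>\<close> is an integer of absolute value less than 1, hence zero.\<close>
  have key: "real t * \<bar>\<theta>\<bar> \<le> 2 * \<epsilon> * real q"
    if t: "real t * \<bar>\<theta>\<bar> \<le> 1 / 2" "dist_nearest_int (real t * \<gamma>) \<le> 2 * \<epsilon>" for t
  proof -
    define b where "b = round (real t * \<gamma>)"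
    define \<phi> where "\<phi> = real t * \<gamma> - of_int b"
    have \<phi>: "\<bar>\<phi>\<bar> \<le> 2 * \<epsilon>" using t by (simp add: \<phi>_def b_def dist_nearest_int_eq)
    have eq: "of_int (int q * b - int t * a) = real t * \<theta> - real q * \<phi>"
      by (simp add: \<theta>_def \<phi>_def algebra_simps)
    have qphi: "\<bar>real q * \<phi>\<bar> \<le> real q * (2 * \<epsilon>)" using \<phi> by (simp add: abs_mult mult_left_mono)
    have "real q * (2 * \<epsilon>) \<le> 5 * Y * (2 * \<epsilon>)" using q5 eps by (intro mult_right_mono) auto
    also have "\<dots> \<le> 5 * Y ^ 2 * \<epsilon>" using mult_right_mono[OF Y2, of \<epsilon>] eps by simp
    also have "\<dots> < 1 / 2" using eps by (simp add: algebra_simps)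
    finally have "\<bar>real t * \<theta> - real q * \<phi>\<bar> < 1"
      using qphi t(1) abs_triangle_ineq4[of "real t * \<theta>" "real q * \<phi>"] abs_mult[of "real t" \<theta>] by simp
    hence "int q * b - int t * a = 0" unfolding eq[symmetric] by linarith
    hence "real t * \<theta> = real q * \<phi>" using eq by simp
    thus ?thesis using qphi by (metis abs_mult abs_of_nat mult.commute)
  qed
  have "\<bar>\<theta>\<bar> * real N \<le> 40 * \<epsilon> * Y ^ 2"
  proof (cases "\<theta> = 0")
    case True
    thus ?thesis using eps by simp
  next
    case False
    hence pos: "\<bar>\<theta>\<bar> > 0" by simp
    \<comment> \<open>\<open>v\<close> is the largest integer with
      \<open>v * \<bar>\<theta>\<bar> \<le> 1 / 2\<close>; below it \<open>key\<close>
      applies.\<close>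
    define v where "v = nat \<lfloor>1 / (2 * \<bar>\<theta>\<bar>)\<rfloor>"
    have "\<bar>\<theta>\<bar> * (100 * Y ^ 2) \<le> 2 * \<epsilon> * (100 * Y ^ 2)" using q \<theta> Y by (intro mult_right_mono) auto
    hence \<theta>Y: "\<bar>\<theta>\<bar> * (100 * Y ^ 2) \<le> 1" using eps by (simp add: algebra_simps)
    hence big: "1 / (2 * \<bar>\<theta>\<bar>) \<ge> 50 * Y ^ 2" using pos by (simp add: field_simps)
    have v: "real v \<le> 1 / (2 * \<bar>\<theta>\<bar>)" "real v > 1 / (2 * \<bar>\<theta>\<bar>) - 1"
      using pos unfolding v_def by (auto simp: le_nat_floor)
    have v4: "real v \<ge> 4 * Y" using v big Y2 Y by linarith
    have *: "\<bar>\<theta>\<bar> * real u \<le> 40 * \<epsilon> * Y ^ 2" if u: "u \<le> N" "u \<le> v" "real u \<ge> 4 * Y" for u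
    proof -
      obtain t where t: "real u / (2 * Y) - 1 \<le> real t" "t < u"
          "dist_nearest_int (real t * \<gamma>) \<le> 2 * \<epsilon>"
        using pair[of u] u Y by auto
      have "real t \<le> 1 / (2 * \<bar>\<theta>\<bar>)" using t u v by linarith
      hence "real t * \<bar>\<theta>\<bar> \<le> 1 / 2" using pos by (simp add: field_simps)
      from key[OF this t(3)] have "real t * \<bar>\<theta>\<bar> \<le> 2 * \<epsilon> * real q" .
      also have "\<dots> \<le> 2 * \<epsilon> * (5 * Y)" using q5 eps by (intro mult_left_mono) auto
      finally have 1: "real t * \<bar>\<theta>\<bar> \<le> 10 * \<epsilon> * Y" by simp
      have "real u / (4 * Y) \<le> real t" using t(1) u(3) Y by (simp add: field_simps)
      hence "real u / (4 * Y) * \<bar>\<theta>\<bar> \<le> 10 * \<epsilon> * Y"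
        using mult_right_mono[of _ _ "\<bar>\<theta>\<bar>"] 1 by (meson abs_ge_zero order_trans)
      thus ?thesis using Y by (simp add: field_simps power2_eq_square)
    qed
    \<comment> \<open>If \<open>v\<close> exceeds \<open>N\<close>, a window of length
      \<open>N\<close> gives the claim. Otherwise \<open>v * \<bar>\<theta>\<bar>\<close> is at most
      1/5, whereas maximality of \<open>v\<close> puts it above
      \<open>1 / 2 - \<bar>\<theta>\<bar>\<close> with \<open>\<theta>\<close> tiny.\<close>
    show ?thesis
    proof (cases "v \<le> N")
      case False
      thus ?thesis using *[of N] N Y by simp
    next
      case True
      have "\<bar>\<theta>\<bar> * real v \<le> 40 * \<epsilon> * Y ^ 2" using *[of v] True v4 by simp
      also have "\<dots> \<le> 1 / 5" using eps by (simp add: algebra_simps)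
      finally have 1: "\<bar>\<theta>\<bar> * real v \<le> 1 / 5" .
      have "\<bar>\<theta>\<bar> * (1 / (2 * \<bar>\<theta>\<bar>) - 1) < \<bar>\<theta>\<bar> * real v" using v pos by (intro mult_strict_left_mono) auto
      hence "1 / 2 - \<bar>\<theta>\<bar> < 1 / 5" using 1 pos by (simp add: algebra_simps)
      moreover have "\<bar>\<theta>\<bar> * 200 \<le> \<bar>\<theta>\<bar> * (100 * Y ^ 2)" using Y Y2 by (intro mult_left_mono) auto
      ultimately have False using \<theta>Y by linarith
      thus ?thesis ..
    qed
  qed
  thus ?thesis using q1 q5 \<theta> by metis
qed

subsection \<open>Weyl sums\<close>

text \<open>
  \<open>f\<close> behaves like a polynomial of degree at most \<open>k\<close>, where \<open>b\<close> is \<open>k!\<close> times the coefficient of degree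
  \<open>k\<close>: all \<open>k\<close>-fold differences with steps \<open>h\<^sub>1, \<dots>, h\<^sub>k\<close> are the constant \<open>h\<^sub>1 \<cdots> h\<^sub>k b\<close>.
\<close>

primrec poly_phase :: "nat \<Rightarrow> real \<Rightarrow> (nat \<Rightarrow> real) \<Rightarrow> bool" where
  "poly_phase 0 b f \<longleftrightarrow> (\<forall>n. f n = b)"
| "poly_phase (Suc k) b f \<longleftrightarrow> (\<forall>h. poly_phase k (real h * b) (\<lambda>n. f (n + h) - f n))"

lemma poly_phase_add:
  "poly_phase k b f \<Longrightarrow> poly_phase k c g \<Longrightarrow> poly_phase k (b + c) (\<lambda>n. f n + g n)"
proof (induction k arbitrary: b c f g)
  case (Suc k)
  show ?case unfolding poly_phase.simps
  proof
    fix h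
    have "poly_phase k (real h * b + real h * c) (\<lambda>n. (f (n + h) - f n) + (g (n + h) - g n))"
      using Suc.prems by (intro Suc.IH) auto
    thus "poly_phase k (real h * (b + c)) (\<lambda>n. f (n + h) + g (n + h) - (f n + g n))"
      by (simp add: algebra_simps)
  qed
qed auto

lemma poly_phase_scale: "poly_phase k b f \<Longrightarrow> poly_phase k (c * b) (\<lambda>n. c * f n)"
proof (induction k arbitrary: b f)
  case (Suc k)
  show ?case unfolding poly_phase.simps
  proof
    fix h
    have "poly_phase k (c * (real h * b)) (\<lambda>n. c * (f (n + h) - f n))"
      using Suc.prems by (intro Suc.IH) auto
    thus "poly_phase k (real h * (c * b)) (\<lambda>n. c * f (n + h) - c * f n)"
      by (simp add: algebra_simps)
  qed
qed auto

lemma poly_phase_shift: "poly_phase k b f \<Longrightarrow> poly_phase k b (\<lambda>n. f (n + s))"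
proof (induction k arbitrary: b f)
  case (Suc k)
  show ?case unfolding poly_phase.simps
  proof
    fix h
    have "poly_phase k (real h * b) (\<lambda>n. f (n + s + h) - f (n + s))"
      using Suc.prems Suc.IH[of "real h * b" "\<lambda>n. f (n + h) - f n"] by auto
    thus "poly_phase k (real h * b) (\<lambda>n. f (n + h + s) - f (n + s))"
      by (simp add: ac_simps)
  qed
qed auto

lemma poly_phase_0: "poly_phase k 0 (\<lambda>_. 0)"
  by (induction k) auto

text \<open>A \<open>k\<close>-fold difference is constant, so one further difference
  vanishes.\<close>

lemma poly_phase_Suc_0: "poly_phase k b f \<Longrightarrow> poly_phase (Suc k) 0 f"
proof (induction k arbitrary: b f)
  case (Suc k)
  have "poly_phase (Suc k) 0 (\<lambda>n. f (n + h) - f n)" for h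
    using Suc.prems by (intro Suc.IH[of "real h * b"]) simp
  thus ?case by (subst poly_phase.simps) simp
qed auto

lemma poly_phase_lift:
  assumes "poly_phase j b f" "j < k"
  shows "poly_phase k 0 f"
  using assms(2)
proof (induction k)
  case (Suc k)
  thus ?case using assms(1) by (cases "j = k") (auto intro!: poly_phase_Suc_0 simp del: poly_phase.simps)
qed simp

lemma poly_phase_sum_0:
  "(\<And>i. i \<in> I \<Longrightarrow> poly_phase k 0 (f i)) \<Longrightarrow> poly_phase k 0 (\<lambda>n. \<Sum>i\<in>I. f i n)"
proof (induction I rule: infinite_finite_induct)
  case (insert i I)
  thus ?case using poly_phase_add[of k 0 "f i" 0 "\<lambda>n. \<Sum>i\<in>I. f i n"] by simp
qed (auto intro: poly_phase_0)

text \<open>By the binomial theorem the difference with step \<open>h\<close> is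
  \<open>Suc l * h * n ^ l\<close> plus lower powers of \<open>n\<close>, which
  \<open>poly_phase_lift\<close> turns into phases with constant 0. All lower powers occur, hence
  the strong induction.\<close>

lemma poly_phase_power: "poly_phase k (fact k) (\<lambda>n. real n ^ k)"
proof (induction k rule: less_induct)
  case (less k)
  show ?case
  proof (cases k)
    case (Suc l)
    show ?thesis unfolding Suc poly_phase.simps
    proof
      fix h :: nat
      have eq: "(\<lambda>n. real (n + h) ^ Suc l - real n ^ Suc l) =
          (\<lambda>n. (\<Sum>i<l. of_nat (Suc l choose i) * real h ^ (Suc l - i) * real n ^ i)
              + real (Suc l) * real h * real n ^ l)"
      proof
        fix n
        have "real (n + h) ^ Suc l =
            (\<Sum>i\<le>Suc l. of_nat (Suc l choose i) * real n ^ i * real h ^ (Suc l - i))"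
          unfolding of_nat_add by (rule binomial_ring)
        also have "\<dots> = (\<Sum>i<l. of_nat (Suc l choose i) * real n ^ i * real h ^ (Suc l - i))
            + real (Suc l) * real n ^ l * real h + real n ^ Suc l"
          unfolding lessThan_Suc_atMost[symmetric] sum.lessThan_Suc by simp
        finally show "real (n + h) ^ Suc l - real n ^ Suc l =
            (\<Sum>i<l. of_nat (Suc l choose i) * real h ^ (Suc l - i) * real n ^ i)
              + real (Suc l) * real h * real n ^ l"
          by (simp only: mult.assoc mult.commute[of "real h ^ _"] mult.commute[of "real h"] add_diff_cancel)
      qed
      have "poly_phase l (0 + real (Suc l) * real h * fact l)
         (\<lambda>n. (\<Sum>i<l. of_nat (Suc l choose i) * real h ^ (Suc l - i) * real n ^ i)
              + real (Suc l) * real h * real n ^ l)"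
      proof (intro poly_phase_add poly_phase_sum_0 poly_phase_scale less.IH)
        show "poly_phase l 0 (\<lambda>n. of_nat (Suc l choose i) * real h ^ (Suc l - i) * real n ^ i)"
          if "i \<in> {..<l}" for i
          using that Suc by (intro poly_phase_lift[OF poly_phase_scale[OF less.IH]]) auto
      qed (use Suc in auto)
      thus "poly_phase l (real h * fact (Suc l)) (\<lambda>n. real (n + h) ^ Suc l - real n ^ Suc l)"
        unfolding eq by (simp add: algebra_simps)
    qed
  qed auto
qed

text \<open>Weyl differencing: when the square is expanded, the diagonal gives \<open>N\<close>, the
  pairs with \<open>m < n\<close> form \<open>U\<close> and are grouped by their difference
  \<open>h\<close>, and the remaining pairs are their conjugates.\<close>

lemma norm_sum_sq_le_correlations:
  fixes z :: "nat \<Rightarrow> complex"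
  assumes z: "\<And>n. norm (z n) = 1"
  shows "(norm (\<Sum>n<N. z n))\<^sup>2 \<le> real N + 2 * (\<Sum>h=1..<N. norm (\<Sum>n<N - h. z (n + h) * cnj (z n)))"
proof -
  define U where "U = (\<lambda>N. \<Sum>n<N. \<Sum>m<n. z n * cnj (z m))"
  have U: "(\<Sum>n<N. z n) * cnj (\<Sum>n<N. z n) = of_nat N + U N + cnj (U N)"
  proof (induction N)
    case (Suc N)
    have "z N * cnj (z N) = 1" using z[of N] by (simp add: complex_mult_cnj cmod_def)
    moreover have "U (Suc N) = U N + z N * cnj (\<Sum>n<N. z n)"
      by (simp add: U_def sum_distrib_left)
    ultimately show ?case using Suc by (simp add: algebra_simps)
  qed (simp add: U_def)
  have "U N = (\<Sum>(n, m)\<in>(SIGMA n:{..<N}. {..<n}). z n * cnj (z m))"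
    unfolding U_def by (subst sum.Sigma) auto
  also have "\<dots> = (\<Sum>(h, n)\<in>(SIGMA h:{1..<N}. {..<N - h}). z (n + h) * cnj (z n))"
    by (rule sum.reindex_bij_witness[where i = "\<lambda>(h, n). (n + h, n)" and j = "\<lambda>(n, m). (n - m, m)"]) auto
  also have "\<dots> = (\<Sum>h=1..<N. \<Sum>n<N - h. z (n + h) * cnj (z n))"
    by (subst sum.Sigma) auto
  finally have "norm (U N) \<le> (\<Sum>h=1..<N. norm (\<Sum>n<N - h. z (n + h) * cnj (z n)))"
    by (simp add: norm_sum)
  moreover have "(norm (\<Sum>n<N. z n))\<^sup>2 = norm (of_nat N + U N + cnj (U N))"
    unfolding U[symmetric] by (simp only: norm_mult complex_mod_cnj power2_eq_square)
  moreover have "norm (of_nat N + U N + cnj (U N)) \<le> real N + norm (U N) + norm (U N)"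
    by (intro norm_triangle_mono) auto
  ultimately show ?thesis by linarith
qed

text \<open>Multiplication by \<open>1 - w\<close> telescopes the geometric sum to
  \<open>1 - w ^ N\<close>, of norm at most 2; the phase \<open>c\<close> factors out with norm
  1.\<close>

lemma norm_geometric_cis_le:
  "norm (\<Sum>n<N. cis (2 * pi * (c + real n * b))) * (4 * dist_nearest_int b) \<le> 2"
proof -
  define w where "w = cis (2 * pi * b)"
  have "cis (2 * pi * (c + real n * b)) = cis (2 * pi * c) * w ^ n" for n
    unfolding w_def Complex.DeMoivre cis_mult by (rule arg_cong[of _ _ cis]) (simp add: algebra_simps)
  hence "norm (\<Sum>n<N. cis (2 * pi * (c + real n * b))) = norm (\<Sum>n<N. w ^ n)"
    by (simp add: norm_mult flip: sum_distrib_left)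
  moreover have "norm (1 - w) * norm (\<Sum>n<N. w ^ n) \<le> 2"
  proof -
    have "norm (1 - w) * norm (\<Sum>n<N. w ^ n) = norm (1 - w ^ N)"
      by (simp only: one_diff_power_eq norm_mult)
    also have "\<dots> \<le> 2" using norm_triangle_ineq4[of 1 "w ^ N"] by (simp add: w_def norm_power)
    finally show ?thesis .
  qed
  moreover have "4 * dist_nearest_int b \<le> norm (1 - w)"
    unfolding w_def by (rule norm_one_minus_cis_ge)
  hence "norm (\<Sum>n<N. w ^ n) * (4 * dist_nearest_int b) \<le> norm (\<Sum>n<N. w ^ n) * norm (1 - w)"
    by (intro mult_left_mono) auto
  ultimately show ?thesis by (simp only: mult.commute[of "norm (1 - w)"])
qed

text \<open>Induction on \<open>k\<close> by Weyl differencing. Many steps \<open>h\<close> have a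
  large differenced sum, so by induction each such \<open>h * b\<close> has a small denominator. One
  denominator \<open>q\<close> serves many \<open>h\<close>, and
  \<open>ex_small_multiplier_of_many_small\<close> then removes \<open>h\<close> and gains the
  missing factor \<open>N\<close>. All losses are powers of \<open>X\<close> with exponents
  depending only on \<open>k\<close>.\<close>

lemma weyl_inverse:
  assumes "k \<ge> 1"
  shows "\<exists>C::nat. \<forall>f b N X. poly_phase k b f \<longrightarrow> X \<ge> 2 \<longrightarrow> N \<ge> 1 \<longrightarrow>
     real N \<le> X * norm (\<Sum>n<N. cis (2 * pi * f n)) \<longrightarrow>
     (\<exists>q\<ge>1. real q \<le> X ^ C \<and> dist_nearest_int (real q * b) * real N ^ k \<le> X ^ C)"
  using assms
proof (induction k rule: nat_induct_at_least)
  case base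
  have linear: "\<exists>q\<ge>1. real q \<le> X ^ 1 \<and> dist_nearest_int (real q * b) * real N ^ 1 \<le> X ^ 1"
    if f: "poly_phase 1 b f" and X: "X \<ge> 2" and N: "N \<ge> 1"
      and S: "real N \<le> X * norm (\<Sum>n<N. cis (2 * pi * f n))" for f b N X
  proof -
    define c where "c = f 0"
    have "f n = c + real n * b" for n
    proof -
      have "f (0 + n) - f 0 = real n * b" using f unfolding One_nat_def poly_phase.simps by blast
      thus ?thesis by (simp add: c_def)
    qed
    hence "norm (\<Sum>n<N. cis (2 * pi * f n)) * (4 * dist_nearest_int b) \<le> 2"
      using norm_geometric_cis_le[of c b N] by simp
    hence "X * (norm (\<Sum>n<N. cis (2 * pi * f n)) * (4 * dist_nearest_int b)) \<le> X * 2"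
      using X by (intro mult_left_mono) auto
    moreover have "real N * (4 * dist_nearest_int b) \<le>
        X * norm (\<Sum>n<N. cis (2 * pi * f n)) * (4 * dist_nearest_int b)"
      using S dist_nearest_int_nonneg by (intro mult_right_mono) auto
    ultimately have "real N * (4 * dist_nearest_int b) \<le> X * 2" by (simp only: mult.assoc)
    hence "dist_nearest_int b * real N \<le> X" using X by (simp add: mult.commute)
    thus ?thesis using X by (intro exI[of _ 1]) auto
  qed
  show ?case by (rule exI[of _ 1], intro allI impI, rule linear)
next
  case (Suc k)
  obtain C where IH: "\<forall>f b N X. poly_phase k b f \<longrightarrow> X \<ge> 2 \<longrightarrow> N \<ge> 1 \<longrightarrow>
     real N \<le> X * norm (\<Sum>n<N. cis (2 * pi * f n)) \<longrightarrow>
     (\<exists>q\<ge>1. real q \<le> X ^ C \<and> dist_nearest_int (real q * b) * real N ^ k \<le> X ^ C)"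
    using Suc.IH by (elim exE)
  \<comment> \<open>\<open>E\<close> bounds every exponent of \<open>Y\<close> that occurs below,
    the largest being \<open>11 * Suc k\<close> from the case of small \<open>N\<close>.\<close>
  define E where "E = 11 * (k + 1) + 9"
  have main: "\<exists>q\<ge>1. real q \<le> X ^ (5 * (C + k + 1) * E) \<and>
      dist_nearest_int (real q * b) * real N ^ Suc k \<le> X ^ (5 * (C + k + 1) * E)"
    if f: "poly_phase (Suc k) b f" and X: "X \<ge> 2" and N: "N \<ge> 1"
      and S: "real N \<le> X * norm (\<Sum>n<N. cis (2 * pi * f n))" for f b N X
  proof -
    \<comment> \<open>\<open>Z\<close> is the loss of one differencing; \<open>Y\<close> also pays
      for the pigeonhole over at most \<open>Z ^ C\<close> denominators and for replacing
      \<open>N - h\<close> by \<open>N\<close>, which costs \<open>Z ^ k\<close>.\<close>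
    define Z where "Z = 8 * X ^ 2"
    define Y where "Y = Z ^ (C + k + 1)"
    have "X ^ 2 \<ge> 2 ^ 2" using X by (intro power_mono) auto
    hence Z2: "Z \<ge> 32" unfolding Z_def by simp
    have "(2::real) ^ 3 * X ^ 2 \<le> X ^ 3 * X ^ 2" using X by (intro mult_right_mono power_mono) auto
    hence ZX: "Z \<le> X ^ 5" unfolding Z_def by (simp flip: power_add)
    have YX: "Y \<le> X ^ (5 * (C + k + 1))"
      unfolding Y_def power_mult using ZX Z2 by (intro power_mono) auto
    have ZpowY: "Z ^ i \<le> Y" if "i \<le> C + k + 1" for i
      unfolding Y_def using Z2 that by (intro power_increasing) auto
    have ZY: "Z \<le> Y" using ZpowY[of 1] by simp
    have Y1: "Y \<ge> 32" using Z2 ZY by simp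
    have YE: "Y ^ i \<le> X ^ (5 * (C + k + 1) * E)" if "i \<le> E" for i
    proof -
      have "Y ^ i \<le> Y ^ E" using Y1 that by (intro power_increasing) auto
      also have "\<dots> \<le> (X ^ (5 * (C + k + 1))) ^ E" using YX Y1 by (intro power_mono) auto
      finally show ?thesis by (simp only: power_mult)
    qed
    show ?thesis
    \<comment> \<open>For \<open>N\<close> up to \<open>Y ^ 11\<close> the denominator 1 already
      works; beyond that \<open>N\<close> dominates the powers of \<open>Y\<close> in the estimates
      below.\<close>
    proof (cases "real N \<le> Y ^ 11")
      case True
      have "dist_nearest_int b * real N ^ Suc k \<le> 1 * (Y ^ 11) ^ Suc k"
        using True dist_nearest_int_le_half[of b] by (intro mult_mono power_mono) auto
      also have "\<dots> = Y ^ (11 * Suc k)" by (simp only: power_mult mult_1)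
      also have "\<dots> \<le> X ^ (5 * (C + k + 1) * E)" by (rule YE) (simp add: E_def)
      finally have "dist_nearest_int b * real N ^ Suc k \<le> X ^ (5 * (C + k + 1) * E)" .
      moreover have "1 \<le> X ^ (5 * (C + k + 1) * E)" using X by (intro one_le_power) auto
      ultimately show ?thesis by (intro exI[of _ 1]) (auto simp del: power_Suc)
    next
      case False
      have Npos: "real N > 0" using N by simp
      define g where "g = (\<lambda>h n. f (n + h) - f n)"
      define T where "T = (\<lambda>h. norm (\<Sum>n<N - h. cis (2 * pi * g h n)))"
      have Tle: "T h \<le> real (N - h)" for h
        unfolding T_def by (rule order_trans[OF norm_sum]) simp
      have "(norm (\<Sum>n<N. cis (2 * pi * f n)))\<^sup>2 \<le> real N + 2 * (\<Sum>h=1..<N. T h)"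
      proof -
        have "cis (2 * pi * f (n + h)) * cnj (cis (2 * pi * f n)) = cis (2 * pi * g h n)" for n h
          unfolding cis_cnj cis_mult by (rule arg_cong[of _ _ cis]) (simp add: g_def algebra_simps)
        thus ?thesis
          using norm_sum_sq_le_correlations[of "\<lambda>n. cis (2 * pi * f n)" N] by (simp add: T_def)
      qed
      hence "X\<^sup>2 * (norm (\<Sum>n<N. cis (2 * pi * f n)))\<^sup>2 \<le> X\<^sup>2 * (real N + 2 * (\<Sum>h=1..<N. T h))"
        by (intro mult_left_mono) auto
      moreover have "(real N)\<^sup>2 \<le> X\<^sup>2 * (norm (\<Sum>n<N. cis (2 * pi * f n)))\<^sup>2"
        unfolding power_mult_distrib[symmetric] using S by (intro power_mono) auto
      moreover have "2 * X\<^sup>2 * real N \<le> (real N)\<^sup>2"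
      proof -
        have "2 * X\<^sup>2 \<le> Z" by (simp add: Z_def)
        also have "\<dots> \<le> Y" by (rule ZY)
        also have "\<dots> \<le> Y ^ 11" using Y1 by (intro self_le_power) auto
        finally show ?thesis using False by (simp add: power2_eq_square mult_right_mono)
      qed
      ultimately have "2 * (real N)\<^sup>2 \<le> Z * (\<Sum>h=1..<N. T h)"
        by (simp add: Z_def algebra_simps)
      \<comment> \<open>The steps outside \<open>H\<close> contribute at most \<open>N\<close> each,
        together at most half of the lower bound \<open>2 * N\<^sup>2\<close>. The other half must
        come from \<open>H\<close>, which forces at least \<open>N / Z\<close> elements.\<close>
      define H where "H = {h\<in>{1..<N}. real N \<le> Z * T h}"
      have HN: "{1..<N} \<inter> H = H" by (auto simp: H_def)
      have "(\<Sum>h=1..<N. Z * T h) \<le> (\<Sum>h=1..<N. real N + (if h \<in> H then Z * real N else 0))"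
      proof (intro sum_mono)
        fix h assume h: "h \<in> {1..<N}"
        have "Z * T h \<le> Z * real N"
          using Tle[of h] Z2 by (intro mult_left_mono) (auto intro: order_trans)
        thus "Z * T h \<le> real N + (if h \<in> H then Z * real N else 0)"
          using h by (auto simp: H_def)
      qed
      also have "\<dots> = real (N - 1) * real N + real (card H) * (Z * real N)"
        by (simp add: sum.distrib HN[simplified] flip: sum.inter_restrict)
      also have "\<dots> \<le> real N * real N + real (card H) * (Z * real N)"
        by (intro add_right_mono mult_right_mono) auto
      finally have "2 * (real N)\<^sup>2 \<le> real N * real N + real (card H) * (Z * real N)"
        using \<open>2 * (real N)\<^sup>2 \<le> Z * (\<Sum>h=1..<N. T h)\<close> by (simp add: sum_distrib_left)
      hence "real N * real N \<le> (Z * real (card H)) * real N" by (simp add: power2_eq_square algebra_simps)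
      hence cardH: "real N \<le> Z * real (card H)" using Npos by simp
      have finH: "finite H" unfolding H_def by simp
      have "\<exists>q\<ge>1. real q \<le> Z ^ C \<and> dist_nearest_int (real q * (real h * b)) * real N ^ k \<le> Z ^ (C + k)"
        if h: "h \<in> H" for h
      proof -
        have hN: "h < N" "real N \<le> Z * T h" using h by (auto simp: H_def)
        have g: "poly_phase k (real h * b) (g h)" using f by (simp add: g_def)
        have len: "N - h \<ge> 1" "real (N - h) \<le> Z * norm (\<Sum>n<N - h. cis (2 * pi * g h n))"
          using hN by (auto simp: T_def)
        have "Z \<ge> 2" using Z2 by simp
        then obtain q where q: "q \<ge> 1" "real q \<le> Z ^ C"
            "dist_nearest_int (real q * (real h * b)) * real (N - h) ^ k \<le> Z ^ C"
          using IH[rule_format, OF g _ len] by blast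
        \<comment> \<open>As \<open>T h\<close> is at most \<open>N - h\<close>, a step in
          \<open>H\<close> leaves a range of length at least \<open>N / Z\<close>.\<close>
        have "real N \<le> Z * real (N - h)" using hN(2) Tle[of h] Z2
          by (meson mult_left_mono order_trans zero_le_numeral)
        hence "real N ^ k \<le> (Z * real (N - h)) ^ k" by (intro power_mono) auto
        hence "dist_nearest_int (real q * (real h * b)) * real N ^ k \<le>
            dist_nearest_int (real q * (real h * b)) * (Z * real (N - h)) ^ k"
          using dist_nearest_int_nonneg by (intro mult_left_mono)
        also have "\<dots> = (dist_nearest_int (real q * (real h * b)) * real (N - h) ^ k) * Z ^ k"
          by (simp add: power_mult_distrib)
        also have "\<dots> \<le> Z ^ C * Z ^ k" using q Z2 by (intro mult_right_mono) auto
        finally show ?thesis using q by (auto simp: power_add)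
      qed
      then obtain Q where Q: "\<And>h. h \<in> H \<Longrightarrow> Q h \<ge> 1 \<and> real (Q h) \<le> Z ^ C \<and>
          dist_nearest_int (real (Q h) * (real h * b)) * real N ^ k \<le> Z ^ (C + k)"
        by metis
      \<comment> \<open>Pigeonhole over the denominators: if every class were small, summation would
        give \<open>Y \<le> Z ^ (C + 1)\<close>, which fails because
        \<open>k \<ge> 1\<close>.\<close>
      have "\<exists>q. q \<ge> 1 \<and> real q \<le> Z ^ C \<and> real N \<le> Y * real (card {h\<in>H. Q h = q})"
      proof (rule ccontr)
        assume *: "\<not> ?thesis"
        define M where "M = nat \<lfloor>Z ^ C\<rfloor>"
        have M: "real M \<le> Z ^ C" using Z2 unfolding M_def by (simp add: of_nat_floor)
        have QM: "Q ` H \<subseteq> {1..M}" using Q unfolding M_def by (auto simp: le_nat_floor)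
        have "card H = (\<Sum>q\<in>{1..M}. card {h\<in>H. Q h = q})"
          using card_eq_sum[of H] sum.group[of H "{1..M}" Q "\<lambda>_. 1::nat"] finH QM by simp
        hence "Y * real (card H) = (\<Sum>q\<in>{1..M}. Y * real (card {h\<in>H. Q h = q}))"
          by (simp add: sum_distrib_left)
        also have "\<dots> \<le> (\<Sum>q\<in>{1..M}. real N)"
        proof (intro sum_mono)
          fix q assume "q \<in> {1..M}"
          hence "q \<ge> 1" "real q \<le> Z ^ C" using M by auto
          thus "Y * real (card {h\<in>H. Q h = q}) \<le> real N" using * by force
        qed
        also have "\<dots> \<le> Z ^ C * real N" using M by (simp add: mult_right_mono)
        also have "\<dots> \<le> Z ^ C * (Z * real (card H))" using cardH Z2 by (intro mult_left_mono) auto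
        finally have "Y * real (card H) \<le> Z ^ (C + 1) * real (card H)" by (simp add: mult_ac)
        moreover have "card H > 0" using cardH Npos by (auto intro: Nat.gr0I)
        ultimately have "Y \<le> Z ^ (C + 1)" by simp
        moreover have "Z ^ (C + 1) < Y" unfolding Y_def
          using Z2 Suc.hyps by (intro power_strict_increasing) auto
        ultimately show False by simp
      qed
      then obtain q where q: "q \<ge> 1" "real q \<le> Z ^ C" "real N \<le> Y * real (card {h\<in>H. Q h = q})"
        by blast
      \<comment> \<open>The common error of the multiples \<open>h * (q * b)\<close>;
        \<open>N > Y ^ 11\<close> makes it small enough for the multiplier lemma.\<close>
      define \<epsilon> where "\<epsilon> = Y / real N ^ k"
      have epos: "\<epsilon> > 0" unfolding \<epsilon>_def using Y1 Npos by simp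
      have N11: "Y ^ 11 \<le> real N ^ k"
      proof -
        have "real N \<le> real N ^ k" using Suc.hyps N by (intro self_le_power) auto
        thus ?thesis using False by linarith
      qed
      have "200 * Y ^ 3 \<le> Y ^ 8 * Y ^ 3"
        using power_mono[of 32 Y 8] Y1 by (intro mult_right_mono) auto
      also have "\<dots> \<le> real N ^ k" using N11 by (simp flip: power_add)
      finally have eps: "\<epsilon> * (200 * Y ^ 2) \<le> 1"
        unfolding \<epsilon>_def using Npos by (simp add: field_simps power2_eq_square power3_eq_cube)
      have "5 * Y \<le> Y ^ 10 * Y"
        using power_mono[of 32 Y 10] Y1 by (intro mult_right_mono) auto
      also have "\<dots> = Y ^ 11" by (simp add: power_numeral_reduce)
      finally have NY: "5 * Y \<le> real N" using False by simp
      have small: "dist_nearest_int (real h * (real q * b)) \<le> \<epsilon>" if "h \<in> {h\<in>H. Q h = q}" for h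
      proof -
        have "dist_nearest_int (real h * (real q * b)) * real N ^ k \<le> Z ^ (C + k)"
          using Q[of h] that by (simp add: mult_ac)
        also have "\<dots> \<le> Y" by (rule ZpowY) simp
        finally show ?thesis using Npos by (simp add: \<epsilon>_def field_simps)
      qed
      have sub: "{h\<in>H. Q h = q} \<subseteq> {..<N}" by (auto simp: H_def)
      obtain t where t: "t \<ge> 1" "real t \<le> 5 * Y"
          "dist_nearest_int (real t * (real q * b)) * real N \<le> 40 * \<epsilon> * Y ^ 2"
        using ex_small_multiplier_of_many_small[OF sub q(3) _ NY epos eps small] Y1 by auto
      have "real (q * t) \<le> Z ^ C * (5 * Y)" unfolding of_nat_mult
        using q t Z2 by (intro mult_mono) auto
      also have "\<dots> \<le> Y * (Y * Y)" using ZpowY[of C] Y1 by (intro mult_mono) auto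
      also have "\<dots> = Y ^ 3" by (simp add: power3_eq_cube)
      also have "\<dots> \<le> X ^ (5 * (C + k + 1) * E)" by (rule YE) (simp add: E_def)
      finally have qt: "real (q * t) \<le> X ^ (5 * (C + k + 1) * E)" .
      have "dist_nearest_int (real (q * t) * b) * real N ^ Suc k =
          (dist_nearest_int (real t * (real q * b)) * real N) * real N ^ k" by (simp add: mult_ac)
      also have "\<dots> \<le> 40 * \<epsilon> * Y ^ 2 * real N ^ k" using t by (intro mult_right_mono) auto
      also have "\<dots> = 40 * Y ^ 3" unfolding \<epsilon>_def using Npos by (simp add: power2_eq_square power3_eq_cube)
      also have "\<dots> \<le> Y ^ 8 * Y ^ 3"
        using power_mono[of 32 Y 8] Y1 by (intro mult_right_mono) auto
      also have "\<dots> = Y ^ 11" by (simp flip: power_add)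
      also have "\<dots> \<le> X ^ (5 * (C + k + 1) * E)" by (rule YE) (simp add: E_def)
      finally show ?thesis using qt q t by (intro exI[of _ "q * t"]) (auto simp del: power_Suc)
    qed
  qed
  show ?case by (rule exI[of _ "5 * (C + k + 1) * E"], intro allI impI, rule main)
qed

subsection \<open>Frequencies with a large exponential sum\<close>

definition dot_int :: "nat \<Rightarrow> (nat \<Rightarrow> int) \<Rightarrow> (nat \<Rightarrow> real) \<Rightarrow> real" where
  "dot_int d \<xi> x = (\<Sum>j<d. of_int (\<xi> j) * x j)"

section \<open>The cosine kernel and its Fourier coefficients\<close>

lemma cis_sum: "cis (\<Sum>j\<in>J. f j) = (\<Prod>j\<in>J. cis (f j))"
  by (induction J rule: infinite_finite_induct) (auto simp flip: cis_mult)

text \<open>Binomial expansion of the cosine as half the sum of two exponentials. The even exponent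
  makes the frequencies integers, and the coefficients are visibly nonnegative.\<close>

lemma cos_power_expansion:
  "complex_of_real (cos (pi * x) ^ (2 * m)) =
     (\<Sum>i\<le>2 * m. of_real (real (2 * m choose i) / 4 ^ m) * cis (2 * pi * (of_int (int i - int m) * x)))"
proof -
  have "complex_of_real (cos (pi * x)) = (cis (pi * x) + cis (- (pi * x))) / 2"
    by (simp add: complex_eq_iff)
  hence "complex_of_real (cos (pi * x) ^ (2 * m)) = ((cis (pi * x) + cis (- (pi * x))) / 2) ^ (2 * m)"
    by (simp only: of_real_power)
  also have "\<dots> = (cis (pi * x) + cis (- (pi * x))) ^ (2 * m) / 4 ^ m"
    by (simp add: power_divide power_mult)
  also have "\<dots> = (\<Sum>i\<le>2 * m. of_nat (2 * m choose i) * cis (pi * x) ^ i * cis (- (pi * x)) ^ (2 * m - i)) / 4 ^ m"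
    by (subst binomial_ring) simp
  also have "\<dots> = (\<Sum>i\<le>2 * m. of_real (real (2 * m choose i) / 4 ^ m) * cis (2 * pi * (of_int (int i - int m) * x)))"
    unfolding sum_divide_distrib
  proof (rule sum.cong)
    fix i assume i: "i \<in> {..2 * m}"
    have "cis (pi * x) ^ i * cis (- (pi * x)) ^ (2 * m - i) = cis (2 * pi * (of_int (int i - int m) * x))"
      unfolding Complex.DeMoivre cis_mult using i
      by (intro arg_cong[of _ _ cis]) (simp add: of_nat_diff algebra_simps)
    thus "of_nat (2 * m choose i) * cis (pi * x) ^ i * cis (- (pi * x)) ^ (2 * m - i) / 4 ^ m =
        of_real (real (2 * m choose i) / 4 ^ m) * cis (2 * pi * (of_int (int i - int m) * x))"
      by (simp add: mult.assoc)
  qed simp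
  finally show ?thesis .
qed

text \<open>The one-dimensional expansions are multiplied out; the index \<open>\<phi>\<close>
  stands for the frequency vector with entries \<open>\<phi> j - m\<close>.\<close>

lemma prod_cos_power_expansion:
  "complex_of_real (\<Prod>j<d. cos (pi * x j) ^ (2 * m)) =
     (\<Sum>\<phi>\<in>PiE {..<d} (\<lambda>_. {..2 * m}). of_real (\<Prod>j<d. real (2 * m choose \<phi> j) / 4 ^ m) *
        cis (2 * pi * dot_int d (\<lambda>j. int (\<phi> j) - int m) x))"
proof -
  have "complex_of_real (\<Prod>j<d. cos (pi * x j) ^ (2 * m)) =
      (\<Prod>j<d. \<Sum>i\<le>2 * m. of_real (real (2 * m choose i) / 4 ^ m) * cis (2 * pi * (of_int (int i - int m) * x j)))"
    unfolding of_real_prod cos_power_expansion ..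
  also have "\<dots> = (\<Sum>\<phi>\<in>PiE {..<d} (\<lambda>_. {..2 * m}). \<Prod>j<d. of_real (real (2 * m choose \<phi> j) / 4 ^ m) *
        cis (2 * pi * (of_int (int (\<phi> j) - int m) * x j)))"
    by (rule prod_sum_PiE) auto
  also have "\<dots> = (\<Sum>\<phi>\<in>PiE {..<d} (\<lambda>_. {..2 * m}). of_real (\<Prod>j<d. real (2 * m choose \<phi> j) / 4 ^ m) *
        cis (2 * pi * dot_int d (\<lambda>j. int (\<phi> j) - int m) x))"
    unfolding dot_int_def sum_distrib_left cis_sum prod.distrib of_real_prod ..
  finally show ?thesis .
qed

text \<open>The central coefficient is the largest of \<open>2 * m + 1\<close> summands with sum
  \<open>4 ^ m\<close>. This bounds the weight of frequency 0 in the kernel from below.\<close>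

lemma central_binomial_ge: "1 / real (2 * m + 1) \<le> real (2 * m choose m) / 4 ^ m"
proof -
  have "(4::nat) ^ m = (\<Sum>i\<le>2 * m. 2 * m choose i)"
    by (simp add: choose_row_sum power_mult)
  also have "\<dots> \<le> (\<Sum>i\<le>2 * m. 2 * m choose m)"
    by (intro sum_mono binomial_maximum')
  finally have "4 ^ m \<le> (2 * m + 1) * (2 * m choose m)" by simp
  hence "real (4 ^ m) \<le> real ((2 * m + 1) * (2 * m choose m))" by (rule of_nat_mono)
  thus ?thesis by (simp add: field_simps)
qed

text \<open>Follows from cos^2 = 1 - sin^2, the lower bound \<open>2 * \<delta>\<close> for the
  sine, and \<open>1 - u \<le> exp (- u)\<close>.\<close>

lemma cos_power_le:
  assumes "dist_nearest_int x > \<delta>" "\<delta> > 0"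
  shows "cos (pi * x) ^ (2 * m) \<le> exp (- 4 * \<delta>\<^sup>2 * real m)"
proof -
  have "(2 * \<delta>)\<^sup>2 \<le> \<bar>sin (pi * x)\<bar>\<^sup>2" using abs_sin_pi_ge[of x] assms by (intro power_mono) auto
  hence "(cos (pi * x))\<^sup>2 \<le> 1 - 4 * \<delta>\<^sup>2"
    unfolding cos_squared_eq by (simp add: power_mult_distrib)
  also have "\<dots> \<le> exp (- 4 * \<delta>\<^sup>2)" using exp_ge_add_one_self[of "- 4 * \<delta>\<^sup>2"] by simp
  finally have "((cos (pi * x))\<^sup>2) ^ m \<le> exp (- 4 * \<delta>\<^sup>2) ^ m" by (intro power_mono) auto
  thus ?thesis unfolding power_mult exp_of_nat_mult[symmetric] by (simp only: mult.commute)
qed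

text \<open>The kernel is tiny at every point of the orbit, yet frequency 0 alone contributes at
  least \<open>1 / (2 * m + 1) ^ d\<close> to its average. Frequencies in \<open>G\<close>, those
  already dealt with, cannot cancel this because their cosines are nonnegative, so some other
  frequency must have a large sum.\<close>

lemma ex_large_exponential_sum:
  fixes x :: "nat \<Rightarrow> nat \<Rightarrow> real" and G :: "(nat \<Rightarrow> int) \<Rightarrow> bool"
  assumes N: "N \<ge> 1" and \<delta>: "\<delta> > 0" and m: "exp (- 4 * \<delta>\<^sup>2 * real m) * (2 * real (2 * m + 1) ^ d) < 1"
    and avoid: "\<And>n. n < N \<Longrightarrow> \<exists>j<d. dist_nearest_int (x n j) > \<delta>"
    and good: "\<And>\<xi> n. G \<xi> \<Longrightarrow> n < N \<Longrightarrow> cos (2 * pi * dot_int d \<xi> (x n)) \<ge> 0"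
  shows "\<exists>\<xi>. (\<forall>j<d. \<bar>\<xi> j\<bar> \<le> int m) \<and> \<not> G \<xi> \<and>
    real N \<le> 2 * real (2 * m + 1) ^ d * norm (\<Sum>n<N. cis (2 * pi * dot_int d \<xi> (x n)))"
proof (rule ccontr)
  assume no: "\<not> ?thesis"
  define I where "I = PiE {..<d} (\<lambda>_. {..2 * m})"
  define c where "c = (\<lambda>\<phi>. \<Prod>j<d. real (2 * m choose \<phi> j) / 4 ^ m)"
  define \<xi> where "\<xi> = (\<lambda>(\<phi>::nat \<Rightarrow> nat) j. int (\<phi> j) - int m)"
  define P where "P = real (2 * m + 1) ^ d"
  \<comment> \<open>The index of frequency 0.\<close>
  define \<phi>0 where "\<phi>0 = (\<lambda>j\<in>{..<d}. m)"
  define F where "F = (\<lambda>y. \<Prod>j<d. cos (pi * y j) ^ (2 * m) :: real)"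
  have P: "P > 0" unfolding P_def by simp
  have finI: "finite I" unfolding I_def by (intro finite_PiE) auto
  have \<phi>0: "\<phi>0 \<in> I" unfolding I_def \<phi>0_def by auto
  have cnn: "c \<phi> \<ge> 0" for \<phi> unfolding c_def by (intro prod_nonneg) auto
  have cos01: "0 \<le> cos t ^ (2 * m) \<and> cos t ^ (2 * m) \<le> 1" for t :: real
    unfolding power_mult by (simp add: power_le_one abs_square_le_1)
  have Re_times: "Re (of_real r * cis t) = r * cos t" for r t by simp
  have F: "F y = (\<Sum>\<phi>\<in>I. c \<phi> * cos (2 * pi * dot_int d (\<xi> \<phi>) y))" for y
  proof -
    have "F y = Re (complex_of_real (F y))" by simp
    also have "\<dots> = (\<Sum>\<phi>\<in>I. c \<phi> * cos (2 * pi * dot_int d (\<xi> \<phi>) y))"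
      unfolding F_def prod_cos_power_expansion I_def c_def \<xi>_def Re_sum Re_times ..
    finally show ?thesis .
  qed
  \<comment> \<open>At the origin every cosine equals 1.\<close>
  have csum: "(\<Sum>\<phi>\<in>I. c \<phi>) = 1"
    using F[of "\<lambda>_. 0"] by (simp add: F_def dot_int_def)
  have c0: "1 / P \<le> c \<phi>0"
  proof -
    have "1 / P = (\<Prod>j<d. 1 / real (2 * m + 1))" by (simp add: P_def power_divide)
    also have "\<dots> \<le> (\<Prod>j<d. real (2 * m choose m) / 4 ^ m)"
      using central_binomial_ge[of m] by (intro prod_mono) auto
    also have "\<dots> = c \<phi>0" by (simp add: c_def \<phi>0_def)
    finally show ?thesis .
  qed
  \<comment> \<open>Frequency 0 carries the negative term as well, so that \<open>csum\<close>
    evaluates the sum of all negative terms.\<close>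
  have lower: "- (c \<phi> * (real N / (2 * P))) + (if \<phi> = \<phi>0 then real N / P else 0)
      \<le> c \<phi> * (\<Sum>n<N. cos (2 * pi * dot_int d (\<xi> \<phi>) (x n)))" if \<phi>: "\<phi> \<in> I" for \<phi>
  proof (cases "\<phi> = \<phi>0")
    case True
    have "dot_int d (\<xi> \<phi>) (x n) = 0" for n by (simp add: True dot_int_def \<xi>_def \<phi>0_def)
    hence "c \<phi> * (\<Sum>n<N. cos (2 * pi * dot_int d (\<xi> \<phi>) (x n))) = c \<phi>0 * real N" by (simp add: True)
    moreover have "real N / P \<le> c \<phi>0 * real N"
      using mult_right_mono[OF c0, of "real N"] by simp
    moreover have "0 \<le> c \<phi> * (real N / (2 * P))" using cnn P by simp
    ultimately show ?thesis by (simp only: True refl if_True)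
  next
    case False
    have "- (real N / (2 * P)) \<le> (\<Sum>n<N. cos (2 * pi * dot_int d (\<xi> \<phi>) (x n)))"
    proof (cases "G (\<xi> \<phi>)")
      case True
      have "0 \<le> (\<Sum>n<N. cos (2 * pi * dot_int d (\<xi> \<phi>) (x n)))"
        by (intro sum_nonneg good[OF True]) auto
      moreover have "0 \<le> real N / (2 * P)" using P by simp
      ultimately show ?thesis by linarith
    next
      case nG: False
      define W where "W = (\<Sum>n<N. cis (2 * pi * dot_int d (\<xi> \<phi>) (x n)))"
      have "\<forall>j<d. \<bar>\<xi> \<phi> j\<bar> \<le> int m"
      proof safe
        fix j assume "j < d"
        hence "\<phi> j \<le> 2 * m" using \<phi> by (auto simp: I_def)
        thus "\<bar>\<xi> \<phi> j\<bar> \<le> int m" by (simp add: \<xi>_def)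
      qed
      hence "\<not> real N \<le> 2 * P * norm W" using no nG unfolding W_def P_def by blast
      hence "norm W < real N / (2 * P)" using P by (simp add: field_simps)
      moreover have "Re W = (\<Sum>n<N. cos (2 * pi * dot_int d (\<xi> \<phi>) (x n)))"
        by (simp add: W_def)
      ultimately show ?thesis using abs_Re_le_cmod[of W] by linarith
    qed
    hence "c \<phi> * - (real N / (2 * P)) \<le> c \<phi> * (\<Sum>n<N. cos (2 * pi * dot_int d (\<xi> \<phi>) (x n)))"
      using cnn by (intro mult_left_mono) auto
    thus ?thesis using False by simp
  qed
  have "(\<Sum>n<N. F (x n)) = (\<Sum>\<phi>\<in>I. c \<phi> * (\<Sum>n<N. cos (2 * pi * dot_int d (\<xi> \<phi>) (x n))))"
    unfolding F sum_distrib_left by (rule sum.swap)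
  also have "\<dots> \<ge> (\<Sum>\<phi>\<in>I. - (c \<phi> * (real N / (2 * P))) + (if \<phi> = \<phi>0 then real N / P else 0))"
    by (intro sum_mono lower)
  also have "(\<Sum>\<phi>\<in>I. - (c \<phi> * (real N / (2 * P))) + (if \<phi> = \<phi>0 then real N / P else 0)) =
      - ((\<Sum>\<phi>\<in>I. c \<phi>) * (real N / (2 * P))) + real N / P"
    using finI \<phi>0 by (simp only: sum.distrib sum_negf sum_distrib_right sum.delta if_True)
  finally have "real N / (2 * P) \<le> (\<Sum>n<N. F (x n))" by (simp add: csum)
  \<comment> \<open>By \<open>avoid\<close> one factor of the kernel is small, and the others lie in
    [0, 1].\<close>
  also have "\<dots> \<le> (\<Sum>n<N. exp (- 4 * \<delta>\<^sup>2 * real m))"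
  proof (intro sum_mono)
    fix n assume "n \<in> {..<N}"
    then obtain j where j: "j < d" "dist_nearest_int (x n j) > \<delta>" using avoid by auto
    have "F (x n) = cos (pi * x n j) ^ (2 * m) * (\<Prod>i\<in>{..<d} - {j}. cos (pi * x n i) ^ (2 * m))"
      unfolding F_def using j by (subst prod.remove[of _ j]) auto
    also have "\<dots> \<le> cos (pi * x n j) ^ (2 * m) * 1"
      using cos01 by (intro mult_left_mono prod_le_1) auto
    also have "\<dots> \<le> exp (- 4 * \<delta>\<^sup>2 * real m)" using cos_power_le[OF j(2) \<delta>, of m] by simp
    finally show "F (x n) \<le> exp (- 4 * \<delta>\<^sup>2 * real m)" .
  qed
  also have "\<dots> = real N * exp (- 4 * \<delta>\<^sup>2 * real m)" by simp
  finally have "real N * 1 \<le> real N * (exp (- 4 * \<delta>\<^sup>2 * real m) * (2 * P))"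
    using P by (simp add: field_simps)
  hence "1 \<le> exp (- 4 * \<delta>\<^sup>2 * real m) * (2 * P)" using N by (subst (asm) mult_le_cancel_left_pos) auto
  thus False using m by (simp add: P_def)
qed

subsection \<open>Chains of frequencies\<close>

text \<open>The coefficients -1, 0, 1 are the possible differences of two indicator values, so a
  coincidence between two subset sums yields a representation of this kind.\<close>

definition in_signed_sums :: "nat \<Rightarrow> nat \<Rightarrow> (nat \<Rightarrow> nat \<Rightarrow> int) \<Rightarrow> (nat \<Rightarrow> int) \<Rightarrow> bool" where
  "in_signed_sums d i \<Xi> \<xi> \<longleftrightarrow>
     (\<exists>a::nat \<Rightarrow> int. (\<forall>l. \<bar>a l\<bar> \<le> 1) \<and> (\<forall>j<d. \<xi> j = (\<Sum>l<i. a l * \<Xi> l j)))"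

lemma in_signed_sums_cong:
  "(\<And>l. l < i \<Longrightarrow> \<Xi> l = \<Xi>' l) \<Longrightarrow> in_signed_sums d i \<Xi> \<xi> = in_signed_sums d i \<Xi>' \<xi>"
  unfolding in_signed_sums_def by simp

lemma inj_on_subset_sums:
  assumes "\<And>l. l < L \<Longrightarrow> \<not> in_signed_sums d l \<Xi> (\<Xi> l)"
  shows "inj_on (\<lambda>S. \<lambda>j\<in>{..<d}. \<Sum>l\<in>S. \<Xi> l j) (Pow {..<L})"
proof (rule inj_onI, rule ccontr)
  fix S T assume S: "S \<in> Pow {..<L}" and T: "T \<in> Pow {..<L}"
    and eq: "(\<lambda>j\<in>{..<d}. \<Sum>l\<in>S. \<Xi> l j) = (\<lambda>j\<in>{..<d}. \<Sum>l\<in>T. \<Xi> l j)" and "S \<noteq> T"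
  define a where "a = (\<lambda>l. of_bool (l \<in> S) - of_bool (l \<in> T) :: int)"
  \<comment> \<open>At the largest index \<open>p\<close> where \<open>S\<close> and \<open>T\<close> differ, \<open>\<Xi> p\<close> is a signed sum of its predecessors.\<close>
  define D where "D = {l \<in> {..<L}. a l \<noteq> 0}"
  have "D \<noteq> {}" using \<open>S \<noteq> T\<close> S T by (auto simp: D_def a_def)
  define p where "p = Max D"
  have "finite D" by (simp add: D_def)
  hence pD: "p \<in> D" and pmax: "\<And>l. l \<in> D \<Longrightarrow> l \<le> p" using \<open>D \<noteq> {}\<close> by (auto simp: p_def)
  have pL: "p < L" and ap: "a p \<noteq> 0" using pD by (auto simp: D_def)
  \<comment> \<open>Since \<open>a p\<close> is 1 or -1, multiplication by \<open>- a p\<close>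
    solves the relation for \<open>\<Xi> p\<close> and keeps the coefficients in -1, 0, 1.\<close>
  have "(\<Sum>l<p. - a p * a l * \<Xi> l j) = \<Xi> p j" if j: "j < d" for j
  proof -
    have expand: "(\<Sum>l\<in>U. \<Xi> l j) = (\<Sum>l<L. of_bool (l \<in> U) * \<Xi> l j)" if "U \<in> Pow {..<L}" for U
      using that by (intro sum.mono_neutral_cong_left) auto
    have "(\<Sum>l\<in>S. \<Xi> l j) = (\<Sum>l\<in>T. \<Xi> l j)" using fun_cong[OF eq, of j] j by simp
    hence "0 = (\<Sum>l<L. a l * \<Xi> l j)"
      unfolding expand[OF S] expand[OF T] a_def left_diff_distrib sum_subtractf by simp
    also have "\<dots> = (\<Sum>l<Suc p. a l * \<Xi> l j)"
    proof (intro sum.mono_neutral_right ballI)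
      fix l assume l: "l \<in> {..<L} - {..<Suc p}"
      hence "l \<notin> D" using pmax[of l] by auto
      thus "a l * \<Xi> l j = 0" using l by (simp add: D_def)
    qed (use pL in auto)
    finally have *: "(\<Sum>l<p. a l * \<Xi> l j) = - (a p * \<Xi> p j)" by simp
    have "(\<Sum>l<p. - a p * a l * \<Xi> l j) = - a p * (\<Sum>l<p. a l * \<Xi> l j)"
      by (simp only: sum_distrib_left mult.assoc)
    also have "\<dots> = a p * a p * \<Xi> p j" unfolding * by simp
    also have "a p * a p = 1" using ap by (auto simp: a_def of_bool_def split: if_splits)
    finally show ?thesis by simp
  qed
  moreover have "\<bar>- a p * a l\<bar> \<le> 1" for l
    by (auto simp: a_def)
  ultimately have "in_signed_sums d p \<Xi> (\<Xi> p)"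
    unfolding in_signed_sums_def by (intro exI[of _ "\<lambda>l. - a p * a l"]) auto
  thus False using assms[OF pL] by contradiction
qed

text \<open>The \<open>2 ^ L\<close> subset sums are distinct points of a box with
  \<open>2 * L * m + 1\<close> integers in each coordinate.\<close>

lemma two_power_le_of_no_signed_sums:
  assumes box: "\<And>l j. l < L \<Longrightarrow> j < d \<Longrightarrow> \<bar>\<Xi> l j\<bar> \<le> int m"
    and "\<And>l. l < L \<Longrightarrow> \<not> in_signed_sums d l \<Xi> (\<Xi> l)"
  shows "2 ^ L \<le> (2 * L * m + 1) ^ d"
proof -
  define B where "B = PiE {..<d} (\<lambda>_. {- int (L * m)..int (L * m)})"
  have "(\<lambda>S. \<lambda>j\<in>{..<d}. \<Sum>l\<in>S. \<Xi> l j) ` Pow {..<L} \<subseteq> B"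
  proof (rule image_subsetI)
    fix S assume S: "S \<in> Pow {..<L}"
    have "\<bar>\<Sum>l\<in>S. \<Xi> l j\<bar> \<le> int (L * m)" if j: "j < d" for j
    proof -
      have "\<bar>\<Sum>l\<in>S. \<Xi> l j\<bar> \<le> (\<Sum>l\<in>S. \<bar>\<Xi> l j\<bar>)" by (rule sum_abs)
      also have "\<dots> \<le> (\<Sum>l<L. \<bar>\<Xi> l j\<bar>)" using S by (intro sum_mono2) auto
      also have "\<dots> \<le> (\<Sum>l<L. int m)" using box j by (intro sum_mono) auto
      finally show ?thesis by simp
    qed
    thus "(\<lambda>j\<in>{..<d}. \<Sum>l\<in>S. \<Xi> l j) \<in> B" unfolding B_def by (auto simp: abs_le_iff minus_le_iff)
  qed
  moreover have "finite B" unfolding B_def by (intro finite_PiE) auto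
  ultimately have "card (Pow {..<L}) \<le> card B"
    using inj_on_subset_sums[OF assms(2)] by (intro card_inj_on_le)
  also have "card B = nat (2 * int (L * m) + 1) ^ d" unfolding B_def by (subst card_PiE) auto
  also have "nat (2 * int (L * m) + 1) = 2 * L * m + 1"
    by (simp add: nat_add_distrib nat_mult_distrib)
  finally show ?thesis by (simp add: card_Pow)
qed

section \<open>Building the chain for monomials\<close>

lemma dot_int_scale: "dot_int d \<xi> (\<lambda>j. c * x j) = c * dot_int d \<xi> x"
  unfolding dot_int_def sum_distrib_left by (intro sum.cong) auto

lemma dot_int_signed_sum:
  assumes "\<forall>j<d. \<xi> j = (\<Sum>l<i. a l * \<Xi> l j)"
  shows "dot_int d \<xi> x = (\<Sum>l<i. of_int (a l) * dot_int d (\<Xi> l) x)"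
proof -
  have "dot_int d \<xi> x = (\<Sum>j<d. \<Sum>l<i. of_int (a l) * (of_int (\<Xi> l j) * x j))"
    unfolding dot_int_def using assms by (intro sum.cong) (auto simp: sum_distrib_right mult.assoc)
  also have "\<dots> = (\<Sum>l<i. of_int (a l) * dot_int d (\<Xi> l) x)"
    unfolding dot_int_def sum_distrib_left by (rule sum.swap)
  finally show ?thesis .
qed

text \<open>Passes smallness from the frequencies found to all their signed sums, by the triangle
  inequality.\<close>

lemma dist_dot_int_signed_sum_le:
  assumes "in_signed_sums d i \<Xi> \<xi>" and "\<And>l. l < i \<Longrightarrow> dist_nearest_int (dot_int d (\<Xi> l) x) \<le> e"
  shows "dist_nearest_int (dot_int d \<xi> x) \<le> real i * e"
proof -
  obtain a where a: "\<And>l. \<bar>a l\<bar> \<le> (1::int)" "\<forall>j<d. \<xi> j = (\<Sum>l<i. a l * \<Xi> l j)"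
    using assms(1) unfolding in_signed_sums_def by blast
  have "dist_nearest_int (dot_int d \<xi> x) \<le> (\<Sum>l<i. dist_nearest_int (of_int (a l) * dot_int d (\<Xi> l) x))"
    unfolding dot_int_signed_sum[OF a(2)] by (rule dist_nearest_int_sum)
  also have "\<dots> \<le> (\<Sum>l<i. e)"
  proof (intro sum_mono)
    fix l assume l: "l \<in> {..<i}"
    have "dist_nearest_int (of_int (a l) * dot_int d (\<Xi> l) x) \<le>
        \<bar>of_int (a l)\<bar> * dist_nearest_int (dot_int d (\<Xi> l) x)" by (rule dist_nearest_int_mult_int)
    also have "\<dots> \<le> 1 * dist_nearest_int (dot_int d (\<Xi> l) x)"
    proof (intro mult_right_mono dist_nearest_int_nonneg)
      show "\<bar>real_of_int (a l)\<bar> \<le> 1" using a(1)[of l] by linarith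
    qed
    finally show "dist_nearest_int (of_int (a l) * dot_int d (\<Xi> l) x) \<le> e" using assms(2)[of l] l by simp
  qed
  finally show ?thesis by simp
qed

text \<open>Were there no such \<open>n\<close>, one could build \<open>L\<close> frequencies in the
  box of radius \<open>m\<close>, none a signed sum of its predecessors, against
  \<open>(2 * L * m + 1) ^ d < 2 ^ L\<close>. Each step uses up a factor \<open>Z\<close> of
  \<open>N\<close>.\<close>

lemma monomial_recurrence_explicit:
  fixes \<alpha> :: "nat \<Rightarrow> real"
  assumes weyl: "\<forall>f b N X. poly_phase k b f \<longrightarrow> X \<ge> 2 \<longrightarrow> N \<ge> 1 \<longrightarrow>
     real N \<le> X * norm (\<Sum>n<N. cis (2 * pi * f n)) \<longrightarrow>
     (\<exists>q\<ge>1. real q \<le> X ^ C \<and> dist_nearest_int (real q * b) * real N ^ k \<le> X ^ C)"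
    and k: "k \<ge> 1" and \<delta>: "\<delta> > 0" and L: "L \<ge> 1" "(2 * L * m + 1) ^ d < 2 ^ L"
    and m: "exp (- 4 * \<delta>\<^sup>2 * real m) * (2 * real (2 * m + 1) ^ d) < 1"
    and Z: "4 * real L * fact k * (2 * real (2 * m + 1) ^ d) ^ C \<le> real Z" and N: "Z ^ L \<le> N"
  shows "\<exists>n. 1 \<le> n \<and> n \<le> N \<and> (\<forall>j<d. dist_nearest_int (\<alpha> j * real n ^ k) \<le> \<delta>)"
proof (rule ccontr)
  assume "\<not> ?thesis"
  hence avoid: "\<exists>j<d. dist_nearest_int (\<alpha> j * real n ^ k) > \<delta>" if "1 \<le> n" "n \<le> N" for n
    using that unfolding not_le[symmetric] by blast
  define X where "X = 2 * real (2 * m + 1) ^ d"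
  have X2: "X \<ge> 2" using one_le_power[of "real (2 * m + 1)" d] unfolding X_def by simp
  have ZX: "4 * real L * fact k * X ^ C \<le> real Z" using Z unfolding X_def .
  have XC: "X ^ C \<ge> 1" using X2 by (intro one_le_power) auto
  have fk: "(fact k :: real) \<ge> 1" by (rule fact_ge_1)
  have "1 * 1 * X ^ C \<le> 4 * real L * fact k * X ^ C"
    using L fk XC by (intro mult_mono) auto
  hence Z1: "real Z \<ge> 1" using ZX XC by linarith
  have ZL: "4 * real L * X ^ C \<le> real Z"
  proof -
    have "4 * real L * 1 * X ^ C \<le> 4 * real L * fact k * X ^ C"
      using fk XC by (intro mult_right_mono mult_left_mono) auto
    thus ?thesis using ZX by linarith
  qed
  have Zf: "X ^ C * fact k \<le> real Z"
  proof -
    have "1 * (fact k * X ^ C) \<le> 4 * real L * (fact k * X ^ C)"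
      using L fk XC by (intro mult_right_mono) auto
    thus ?thesis using ZX by (simp only: mult_ac mult_1)
  qed
  \<comment> \<open>After \<open>i\<close> steps only the multiples \<open>Q * n\<close> with
    \<open>n \<le> N div Z ^ i\<close> are considered. The last bound keeps the phase of any signed
    sum of the frequencies found within 1/4 of an integer for all these \<open>n\<close>.\<close>
  have chain: "\<exists>Q \<Xi>. 1 \<le> Q \<and> Q \<le> Z ^ i \<and> (\<forall>l<i. (\<forall>j<d. \<bar>\<Xi> l j\<bar> \<le> int m) \<and> \<not> in_signed_sums d l \<Xi> (\<Xi> l) \<and>
      dist_nearest_int (real Q ^ k * dot_int d (\<Xi> l) \<alpha>) * (4 * real L * real (N div Z ^ i) ^ k) \<le> 1)"
    if "i \<le> L" for i
    using that
  proof (induction i)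
    case 0
    show ?case by (intro exI[of _ 1]) auto
  next
    case (Suc i)
    then obtain Q \<Xi> where Q: "1 \<le> Q" "Q \<le> Z ^ i"
      and box: "\<And>l j. l < i \<Longrightarrow> j < d \<Longrightarrow> \<bar>\<Xi> l j\<bar> \<le> int m"
      and nis: "\<And>l. l < i \<Longrightarrow> \<not> in_signed_sums d l \<Xi> (\<Xi> l)"
      and small: "\<And>l. l < i \<Longrightarrow> dist_nearest_int (real Q ^ k * dot_int d (\<Xi> l) \<alpha>) *
          (4 * real L * real (N div Z ^ i) ^ k) \<le> 1"
      using Suc_leD by metis
    define M where "M = N div Z ^ i"
    define \<beta> where "\<beta> = (\<lambda>j. real Q ^ k * \<alpha> j)"
    have Zi: "Z ^ i > 0" using Z1 by simp
    have "Z ^ i \<le> Z ^ L" using Z1 Suc.prems by (intro power_increasing) auto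
    hence "Z ^ i \<le> N" using N by simp
    hence M1: "M \<ge> 1" unfolding M_def using Zi by (simp add: Suc_le_eq div_greater_zero_iff)
    define e where "e = 1 / (4 * real L * real M ^ k)"
    have MkL: "4 * real L * real M ^ k > 0" using L M1 by simp
    have dot\<beta>: "dot_int d \<xi> \<beta> = real Q ^ k * dot_int d \<xi> \<alpha>" for \<xi>
      unfolding \<beta>_def by (rule dot_int_scale)
    have small': "dist_nearest_int (dot_int d (\<Xi> l) \<beta>) \<le> e" if "l < i" for l
      using small[OF that] MkL unfolding dot\<beta> M_def[symmetric] e_def by (simp add: pos_le_divide_eq)
    \<comment> \<open>For \<open>n < M\<close> the argument \<open>n + 1\<close> runs from 1 to
      \<open>M\<close>, which keeps 0 out of the orbit.\<close>
    define x where "x = (\<lambda>n j. real (n + 1) ^ k * \<beta> j)"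
    have dotx: "dot_int d \<xi> (x n) = real (n + 1) ^ k * dot_int d \<xi> \<beta>" for \<xi> n
      unfolding x_def by (rule dot_int_scale)
    have avoid': "\<exists>j<d. dist_nearest_int (x n j) > \<delta>" if n: "n < M" for n
    proof -
      have "Q * (n + 1) \<le> Z ^ i * M" using Q n by (intro mult_mono) auto
      also have "\<dots> \<le> N" by (simp add: M_def)
      finally have "\<exists>j<d. dist_nearest_int (\<alpha> j * real (Q * (n + 1)) ^ k) > \<delta>"
        using Q by (intro avoid) auto
      thus ?thesis unfolding x_def \<beta>_def of_nat_mult power_mult_distrib by (simp only: mult_ac)
    qed
    have good: "cos (2 * pi * dot_int d \<xi> (x n)) \<ge> 0" if "in_signed_sums d i \<Xi> \<xi>" "n < M" for \<xi> n
    proof (rule cos_two_pi_nonneg)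
      have "dist_nearest_int (dot_int d \<xi> (x n)) \<le> real (n + 1) ^ k * dist_nearest_int (dot_int d \<xi> \<beta>)"
        unfolding dotx of_nat_power[symmetric] by (rule dist_nearest_int_mult_nat)
      also have "\<dots> \<le> real M ^ k * (real L * e)"
      proof (intro mult_mono power_mono)
        have "dist_nearest_int (dot_int d \<xi> \<beta>) \<le> real i * e"
          by (rule dist_dot_int_signed_sum_le[OF that(1) small'])
        also have "\<dots> \<le> real L * e" using Suc.prems MkL unfolding e_def by (intro mult_right_mono) auto
        finally show "dist_nearest_int (dot_int d \<xi> \<beta>) \<le> real L * e" .
      qed (use that dist_nearest_int_nonneg in auto)
      also have "\<dots> = 1 / 4" using L M1 by (simp add: e_def)
      finally show "dist_nearest_int (dot_int d \<xi> (x n)) \<le> 1 / 4" .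
    qed
    obtain \<xi> where \<xi>: "\<forall>j<d. \<bar>\<xi> j\<bar> \<le> int m" "\<not> in_signed_sums d i \<Xi> \<xi>"
        "real M \<le> X * norm (\<Sum>n<M. cis (2 * pi * dot_int d \<xi> (x n)))"
      using ex_large_exponential_sum[where G = "in_signed_sums d i \<Xi>" and x = x, OF M1 \<delta> m avoid' good]
      unfolding X_def by blast
    define b where "b = dot_int d \<xi> \<beta>"
    have ph: "poly_phase k (b * fact k) (\<lambda>n. dot_int d \<xi> (x n))"
      using poly_phase_scale[OF poly_phase_shift[OF poly_phase_power, where s = 1], of k b]
      unfolding dotx b_def[symmetric] by (simp only: mult.commute)
    obtain q where q: "q \<ge> 1" "real q \<le> X ^ C" "dist_nearest_int (real q * (b * fact k)) * real M ^ k \<le> X ^ C"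
      using weyl[rule_format, OF ph X2 M1 \<xi>(3)] by blast
    \<comment> \<open>The factor \<open>fact k\<close> of the phase constant moves into the
      multiplier, so that \<open>r * b\<close> itself is close to an integer.\<close>
    define r where "r = q * fact k"
    have r1: "r \<ge> 1" using q by (simp add: r_def)
    have rZ: "real r \<le> real Z"
    proof -
      have "real r \<le> X ^ C * fact k" using q(2) by (simp add: r_def)
      thus ?thesis using Zf by simp
    qed
    define M' where "M' = N div Z ^ Suc i"
    have M'eq: "M' = M div Z" unfolding M'_def M_def by (simp add: div_mult2_eq[symmetric] mult.commute)
    have "M' * Z \<le> M" unfolding M'eq by simp
    hence M'M: "real M' * real Z \<le> real M" by (metis of_nat_le_iff of_nat_mult)
    have M'Mk: "real M' ^ k * real Z ^ k \<le> real M ^ k"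
      unfolding power_mult_distrib[symmetric] using M'M by (intro power_mono) auto
    define Q' where "Q' = Q * r"
    define \<Xi>' where "\<Xi>' = \<Xi>(i := \<xi>)"
    have dQ': "real Q' ^ k * dot_int d \<zeta> \<alpha> = real r ^ k * dot_int d \<zeta> \<beta>" for \<zeta>
      by (simp add: Q'_def dot\<beta> power_mult_distrib)
    have new: "dist_nearest_int (real Q' ^ k * dot_int d (\<Xi>' l) \<alpha>) * (4 * real L * real M' ^ k) \<le> 1"
      if l: "l < Suc i" for l
    proof (cases "l = i")
      \<comment> \<open>For an old frequency the loss \<open>Z ^ k\<close> is compensated by
        shortening the range by the factor \<open>Z\<close>.\<close>
      case False
      hence l: "l < i" using l by simp
      have "dist_nearest_int (real Q' ^ k * dot_int d (\<Xi>' l) \<alpha>) \<le> real r ^ k * dist_nearest_int (dot_int d (\<Xi> l) \<beta>)"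
        using False dist_nearest_int_mult_nat[of "r ^ k"] unfolding dQ' by (simp add: \<Xi>'_def)
      also have "\<dots> \<le> real Z ^ k * e" using rZ small'[OF l] dist_nearest_int_nonneg
        by (intro mult_mono power_mono) auto
      finally have "dist_nearest_int (real Q' ^ k * dot_int d (\<Xi>' l) \<alpha>) * (4 * real L * real M' ^ k) \<le>
          real Z ^ k * e * (4 * real L * real M' ^ k)" by (intro mult_right_mono) auto
      also have "\<dots> = (real M' ^ k * real Z ^ k) * (4 * real L * e)" by (simp only: mult_ac)
      also have "\<dots> \<le> real M ^ k * (4 * real L * e)" using M'Mk MkL unfolding e_def by (intro mult_right_mono) auto
      also have "\<dots> = 1" using L M1 unfolding e_def by simp
      finally show ?thesis .
    next
      \<comment> \<open>For the new frequency one of the \<open>k\<close> factors \<open>r\<close>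
        is spent on the approximation and the other \<open>k'\<close> cost \<open>Z ^ k'\<close>.
        The remaining factor \<open>Z\<close> gained from the shorter range absorbs
        \<open>4 * L * X ^ C\<close>.\<close>
      case True
      obtain k' where k': "k = Suc k'" using k by (cases k) auto
      define D where "D = dist_nearest_int (real r * b)"
      have D0: "D \<ge> 0" unfolding D_def by (rule dist_nearest_int_nonneg)
      have DM: "D * real M ^ k \<le> X ^ C" using q(3) unfolding D_def r_def by (simp add: mult_ac)
      have "dist_nearest_int (real Q' ^ k * dot_int d (\<Xi>' l) \<alpha>) = dist_nearest_int (real r ^ k * b)"
        unfolding dQ' b_def by (simp add: True \<Xi>'_def)
      also have "real r ^ k * b = real (r ^ k') * (real r * b)" by (simp add: k' mult_ac)
      also have "dist_nearest_int \<dots> \<le> real (r ^ k') * D" unfolding D_def by (rule dist_nearest_int_mult_nat)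
      also have "\<dots> \<le> real Z ^ k' * D" unfolding of_nat_power using rZ D0 by (intro mult_right_mono power_mono) auto
      finally have "dist_nearest_int (real Q' ^ k * dot_int d (\<Xi>' l) \<alpha>) * (4 * real L * real M' ^ k) * X ^ C \<le>
          real Z ^ k' * D * (4 * real L * real M' ^ k) * X ^ C"
        using XC by (intro mult_right_mono) auto
      also have "\<dots> = (real Z ^ k' * D * real M' ^ k) * (4 * real L * X ^ C)" by (simp only: mult_ac)
      also have "\<dots> \<le> (real Z ^ k' * D * real M' ^ k) * real Z" using ZL D0 by (intro mult_left_mono) auto
      also have "\<dots> = D * (real M' ^ k * real Z ^ k)" by (simp add: k' mult_ac)
      also have "\<dots> \<le> D * real M ^ k" using M'Mk D0 by (intro mult_left_mono) auto
      also have "\<dots> \<le> 1 * X ^ C" using DM by simp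
      finally show ?thesis using XC by (subst (asm) mult_le_cancel_right_pos) auto
    qed
    have nis': "\<not> in_signed_sums d l \<Xi>' (\<Xi>' l)" if l: "l < Suc i" for l
    proof -
      have "in_signed_sums d l \<Xi>' (\<Xi>' l) = in_signed_sums d l \<Xi> (\<Xi>' l)"
        using l by (intro in_signed_sums_cong) (auto simp: \<Xi>'_def)
      thus ?thesis using nis[of l] \<xi>(2) l by (cases "l = i") (auto simp: \<Xi>'_def)
    qed
    have box': "\<bar>\<Xi>' l j\<bar> \<le> int m" if "l < Suc i" "j < d" for l j
      using that box[of l j] \<xi>(1) by (cases "l = i") (auto simp: \<Xi>'_def)
    have Q'1: "1 \<le> Q'" using Q r1 by (simp add: Q'_def)
    have "Q' \<le> Z ^ i * Z" unfolding Q'_def using Q rZ by (intro mult_mono) auto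
    hence Q'Z: "Q' \<le> Z ^ Suc i" by (simp add: mult.commute)
    show ?case
      by (rule exI[of _ Q'], rule exI[of _ \<Xi>'])
        (use Q'1 Q'Z box' nis' new[unfolded M'_def] in blast)
  qed
  obtain \<Xi> where "\<And>l j. l < L \<Longrightarrow> j < d \<Longrightarrow> \<bar>\<Xi> l j\<bar> \<le> int m" "\<And>l. l < L \<Longrightarrow> \<not> in_signed_sums d l \<Xi> (\<Xi> l)"
    using chain[OF order_refl] by blast
  from two_power_le_of_no_signed_sums[of L, OF this] L(2) show False by linarith
qed

subsection \<open>Quantitative recurrence\<close>

text \<open>As \<open>ln (1 / \<delta>) \<ge> 1 / 2\<close>, this single parameter dominates
  \<open>d\<close>, 1 and \<open>ln (1 / \<delta>)\<close>, and all later choices are expressed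
  through it.\<close>

lemma dim_le_of_scale:
  fixes \<delta> :: real
  assumes "d \<ge> 1" "0 < \<delta>" "\<delta> \<le> 1 / 2"
  shows "real d \<le> 2 * (real d * ln (1 / \<delta>))" "1 \<le> 2 * (real d * ln (1 / \<delta>))"
    "1 / \<delta> \<le> exp (2 * (real d * ln (1 / \<delta>)))"
proof -
  have "ln 2 \<le> ln (1 / \<delta>)" using assms by (subst ln_le_cancel_iff) (auto simp: field_simps)
  hence l: "ln (1 / \<delta>) \<ge> 1 / 2" using ln2_ge_two_thirds by linarith
  show d: "real d \<le> 2 * (real d * ln (1 / \<delta>))"
    using mult_left_mono[OF l, of "real d"] by simp
  show "1 \<le> 2 * (real d * ln (1 / \<delta>))" using d assms by linarith
  have "1 * ln (1 / \<delta>) \<le> 2 * real d * ln (1 / \<delta>)" using assms l by (intro mult_right_mono) auto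
  hence "exp (ln (1 / \<delta>)) \<le> exp (2 * (real d * ln (1 / \<delta>)))" by simp
  thus "1 / \<delta> \<le> exp (2 * (real d * ln (1 / \<delta>)))" using assms by simp
qed

lemma nat_ceiling_exp_le:
  fixes t :: real
  assumes "t \<ge> 1"
  shows "real (nat \<lceil>exp t\<rceil>) \<le> exp (2 * t)"
proof -
  have "real (nat \<lceil>exp t\<rceil>) \<le> exp t + 1" using exp_gt_zero[of t] by linarith
  also have "\<dots> \<le> 2 * exp t" using exp_ge_add_one_self[of t] assms by linarith
  also have "\<dots> \<le> exp t * exp t"
  proof (intro mult_right_mono)
    show "2 \<le> exp t" using exp_ge_add_one_self[of t] assms by linarith
  qed simp
  also have "\<dots> = exp (2 * t)" by (simp flip: exp_add)
  finally show ?thesis .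
qed

text \<open>Choice of parameters: with \<open>y = 2 * (d * ln (1 / \<delta>))\<close>, the chain
  length \<open>L\<close> is at most \<open>42 * y\<^sup>2\<close> and \<open>Z\<close> at most
  \<open>exp (W * y\<^sup>2)\<close>, so \<open>Z ^ L\<close> is at most
  \<open>exp (42 * W * y ^ 4)\<close>. This gives the fourth power and the constant 672 = 42 *
  16.\<close>

lemma monomial_recurrence:
  assumes k: "k \<ge> 1"
  shows "\<exists>K\<ge>1. \<forall>d (\<alpha>::nat \<Rightarrow> real) \<delta> N. d \<ge> 1 \<longrightarrow> 0 < \<delta> \<longrightarrow> \<delta> \<le> 1 / 2 \<longrightarrow> N \<ge> 1 \<longrightarrow>
     K * (real d * ln (1 / \<delta>)) ^ 4 \<le> ln (real N) \<longrightarrow>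
     (\<exists>n. 1 \<le> n \<and> n \<le> N \<and> (\<forall>j<d. dist_nearest_int (\<alpha> j * real n ^ k) \<le> \<delta>))"
proof -
  obtain C where weyl: "\<forall>f b N X. poly_phase k b f \<longrightarrow> X \<ge> 2 \<longrightarrow> N \<ge> 1 \<longrightarrow>
     real N \<le> X * norm (\<Sum>n<N. cis (2 * pi * f n)) \<longrightarrow>
     (\<exists>q\<ge>1. real q \<le> X ^ C \<and> dist_nearest_int (real q * b) * real N ^ k \<le> X ^ C)"
    using weyl_inverse[OF k] by (elim exE)
  \<comment> \<open>The summands pay for \<open>4 * L\<close> (168), for \<open>fact k\<close>, for
    \<open>X ^ C\<close>, and with one further unit for rounding \<open>V\<close> up to
    \<open>Z\<close>.\<close>
  define W where "W = 169 + fact k + 9 * real C"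
  have W1: "W \<ge> 1" by (simp add: W_def)
  have main: "\<exists>n. 1 \<le> n \<and> n \<le> N \<and> (\<forall>j<d. dist_nearest_int (\<alpha> j * real n ^ k) \<le> \<delta>)"
    if d: "d \<ge> 1" and \<delta>: "0 < \<delta>" "\<delta> \<le> 1 / 2" and N: "N \<ge> 1"
      and lnN: "672 * W * (real d * ln (1 / \<delta>)) ^ 4 \<le> ln (real N)" for d \<delta> N and \<alpha> :: "nat \<Rightarrow> real"
  proof -
    define y where "y = 2 * (real d * ln (1 / \<delta>))"
    have dy: "real d \<le> y" and y1: "1 \<le> y" and \<delta>y: "1 / \<delta> \<le> exp y"
      using dim_le_of_scale[OF d \<delta>] unfolding y_def by auto
    have ysq: "1 \<le> y\<^sup>2" using y1 by simp
    have exp_ysq: "2 \<le> exp (y\<^sup>2)" using exp_ge_add_one_self[of "y\<^sup>2"] ysq by linarith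
    have exp2y: "2 * y \<le> exp (2 * y)" using exp_ge_add_one_self[of "2 * y"] by linarith
    \<comment> \<open>Together with \<open>\<delta> \<ge> exp (- y)\<close> this gives
      \<open>4 * \<delta>\<^sup>2 * m \<ge> 16 * y\<^sup>2\<close>, which outweighs
      \<open>X \<le> exp (9 * y\<^sup>2)\<close>.\<close>
    define m where "m = nat \<lceil>exp (6 * y)\<rceil>"
    have m_ge: "exp (6 * y) \<le> real m" unfolding m_def by linarith
    have m_le: "real (2 * m + 1) \<le> exp (8 * y)"
    proof -
      have "real m \<le> exp (6 * y) + 1" using exp_gt_zero[of "6 * y"] unfolding m_def by linarith
      moreover have "1 \<le> exp (6 * y)" using y1 by simp
      moreover have "real (2 * m + 1) = 2 * real m + 1" by simp
      ultimately have "real (2 * m + 1) \<le> 5 * exp (6 * y)" by linarith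
      also have "\<dots> \<le> exp (2 * y) * exp (6 * y)"
      proof (intro mult_right_mono)
        have "1 + 2 * y + (2 * y)\<^sup>2 / 2 \<le> exp (2 * y)"
          using y1 by (intro exp_lower_Taylor_quadratic) auto
        moreover have "(2 * y)\<^sup>2 = 4 * y\<^sup>2" by (simp add: power_mult_distrib)
        ultimately show "5 \<le> exp (2 * y)" using y1 ysq by linarith
      qed simp
      also have "\<dots> = exp (8 * y)" by (simp flip: exp_add)
      finally show ?thesis .
    qed
    define X where "X = 2 * real (2 * m + 1) ^ d"
    have X_le: "X \<le> exp (9 * y\<^sup>2)"
    proof -
      have "real (2 * m + 1) ^ d \<le> exp (8 * y) ^ d" using m_le by (intro power_mono) auto
      also have "\<dots> = exp (real d * (8 * y))" by (simp add: exp_of_nat_mult)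
      also have "\<dots> \<le> exp (8 * y\<^sup>2)" using mult_right_mono[OF dy, of y] y1 by (simp add: power2_eq_square)
      finally have "X \<le> 2 * exp (8 * y\<^sup>2)" by (simp add: X_def)
      also have "\<dots> \<le> exp (y\<^sup>2) * exp (8 * y\<^sup>2)"
        using exp_ysq by (intro mult_right_mono) auto
      also have "\<dots> = exp (9 * y\<^sup>2)" by (simp flip: exp_add)
      finally show ?thesis .
    qed
    have m: "exp (- 4 * \<delta>\<^sup>2 * real m) * (2 * real (2 * m + 1) ^ d) < 1"
    proof -
      have "exp (- y) \<le> \<delta>" using \<delta>y \<delta> by (simp add: exp_minus field_simps)
      hence "(exp (- y))\<^sup>2 \<le> \<delta>\<^sup>2" by (intro power_mono) auto
      hence "(exp (- y))\<^sup>2 * exp (6 * y) \<le> \<delta>\<^sup>2 * real m" using m_ge by (intro mult_mono) auto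
      moreover have "(exp (- y))\<^sup>2 * exp (6 * y) = (exp (2 * y))\<^sup>2" by (simp add: power2_eq_square flip: exp_add)
      moreover have "(2 * y)\<^sup>2 \<le> (exp (2 * y))\<^sup>2" using exp2y y1 by (intro power_mono) auto
      ultimately have "4 * y\<^sup>2 \<le> \<delta>\<^sup>2 * real m" by (simp add: power_mult_distrib)
      hence "- 4 * \<delta>\<^sup>2 * real m \<le> - 16 * y\<^sup>2" by (simp add: mult.commute)
      hence "exp (- 4 * \<delta>\<^sup>2 * real m) * X \<le> exp (- 16 * y\<^sup>2) * exp (9 * y\<^sup>2)"
        using X_le by (intro mult_mono) (auto simp: X_def)
      also have "\<dots> = exp (- 7 * y\<^sup>2)" by (simp flip: exp_add)
      also have "\<dots> < 1" using y1 by simp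
      finally show ?thesis by (simp only: X_def)
    qed
    \<comment> \<open>\<open>s\<close> is large enough for \<open>4 * d * m + 1 \<le> 2 ^ s\<close>.
      With \<open>L = 2 * d * s\<close> the box side \<open>2 * L * m + 1\<close> is then below
      \<open>2 ^ (2 * s)\<close>, and its \<open>d\<close>-th power below
      \<open>2 ^ L\<close>.\<close>
    define s where "s = nat \<lceil>20 * y\<rceil>"
    have s_ge: "20 * y \<le> real s" and s_le: "real s \<le> 21 * y" using y1 unfolding s_def by linarith+
    define L where "L = 2 * d * s"
    have L1: "L \<ge> 1" using d s_ge y1 by (simp add: L_def)
    have L_le: "real L \<le> 42 * y\<^sup>2"
    proof -
      have "real d * real s \<le> y * (21 * y)" using dy s_le y1 by (intro mult_mono) auto
      thus ?thesis by (simp add: L_def power2_eq_square)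
    qed
    have two_s: "real (4 * d * m + 1) \<le> 2 ^ s"
    proof -
      have "real (4 * d * m + 1) \<le> 2 * real d * real (2 * m + 1)" using d by (simp add: algebra_simps)
      also have "\<dots> \<le> exp (2 * y) * exp (8 * y)"
      proof (rule mult_mono)
        show "2 * real d \<le> exp (2 * y)" using dy exp2y by linarith
      qed (use m_le in auto)
      also have "\<dots> = exp (10 * y)" by (simp flip: exp_add)
      also have "\<dots> \<le> exp (real s * ln 2)"
      proof -
        have "20 * y * (1 / 2) \<le> real s * ln 2" using s_ge y1 ln2_ge_two_thirds by (intro mult_mono) auto
        thus ?thesis by simp
      qed
      also have "\<dots> = 2 ^ s" by (simp add: exp_of_nat_mult)
      finally show ?thesis .
    qed
    have L2: "(2 * L * m + 1) ^ d < 2 ^ L"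
    proof -
      have a: "4 * d * m + 1 \<le> 2 ^ s" using two_s by (metis of_nat_le_iff of_nat_numeral of_nat_power)
      have "s + 1 \<le> 2 ^ s" using less_exp[of s] by linarith
      hence "(4 * d * m + 1) * (s + 1) \<le> 2 ^ s * 2 ^ s" by (rule mult_le_mono[OF a])
      moreover have "2 * L * m + 1 < (4 * d * m + 1) * (s + 1)" using s_ge y1 by (simp add: L_def algebra_simps)
      ultimately have "2 * L * m + 1 < 2 ^ (2 * s)" by (simp add: mult_2 power_add)
      hence "(2 * L * m + 1) ^ d < (2 ^ (2 * s)) ^ d" using d by (intro power_strict_mono) auto
      thus ?thesis by (simp add: L_def mult_ac flip: power_mult)
    qed
    define V where "V = 4 * real L * fact k * X ^ C"
    define Z where "Z = nat \<lceil>V\<rceil>"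
    have V_le: "V \<le> exp ((168 + fact k + 9 * real C) * y\<^sup>2)"
    proof -
      have "V \<le> exp (168 * y\<^sup>2) * exp (fact k * y\<^sup>2) * exp (real C * (9 * y\<^sup>2))"
        unfolding V_def
      proof (intro mult_mono)
        show "4 * real L \<le> exp (168 * y\<^sup>2)" using L_le exp_ge_add_one_self[of "168 * y\<^sup>2"] by linarith
        have "fact k * 1 \<le> fact k * y\<^sup>2" using ysq by (intro mult_left_mono) auto
        thus "(fact k :: real) \<le> exp (fact k * y\<^sup>2)" using exp_ge_add_one_self[of "fact k * y\<^sup>2"] by linarith
        have "X ^ C \<le> exp (9 * y\<^sup>2) ^ C" using X_le by (intro power_mono) (auto simp: X_def)
        thus "X ^ C \<le> exp (real C * (9 * y\<^sup>2))" by (simp add: exp_of_nat_mult)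
      qed (auto simp: X_def)
      also have "\<dots> = exp ((168 + fact k + 9 * real C) * y\<^sup>2)" by (simp add: algebra_simps flip: exp_add)
      finally show ?thesis .
    qed
    have V_Z: "V \<le> real Z" unfolding Z_def by linarith
    have Z_le: "real Z \<le> exp (W * y\<^sup>2)"
    proof -
      have "V \<ge> 0" by (simp add: V_def X_def)
      hence "real Z \<le> V + 1" unfolding Z_def by linarith
      also have "\<dots> \<le> 2 * exp ((168 + fact k + 9 * real C) * y\<^sup>2)"
      proof -
        have "1 \<le> exp ((168 + fact k + 9 * real C) * y\<^sup>2)" by simp
        thus ?thesis using V_le by linarith
      qed
      also have "\<dots> \<le> exp (y\<^sup>2) * exp ((168 + fact k + 9 * real C) * y\<^sup>2)"
        using exp_ysq by (intro mult_right_mono) auto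
      also have "\<dots> = exp (W * y\<^sup>2)" by (simp add: W_def algebra_simps flip: exp_add)
      finally show ?thesis .
    qed
    have "real (Z ^ L) \<le> exp (W * y\<^sup>2) ^ L" unfolding of_nat_power using Z_le by (intro power_mono) auto
    also have "\<dots> = exp (real L * (W * y\<^sup>2))" by (simp add: exp_of_nat_mult)
    also have "\<dots> \<le> exp (672 * W * (real d * ln (1 / \<delta>)) ^ 4)"
    proof -
      have "real L * (W * y\<^sup>2) \<le> 42 * y\<^sup>2 * (W * y\<^sup>2)" using L_le W1 by (intro mult_right_mono) auto
      also have "\<dots> = 672 * W * (real d * ln (1 / \<delta>)) ^ 4"
        by (simp add: y_def power2_eq_square power4_eq_xxxx)
      finally show ?thesis by simp
    qed
    also have "\<dots> \<le> exp (ln (real N))" using lnN by simp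
    also have "\<dots> = real N" using N by simp
    finally have ZN: "Z ^ L \<le> N" by (simp only: of_nat_le_iff)
    show ?thesis
      by (rule monomial_recurrence_explicit[OF weyl k \<delta>(1) L1 L2 m V_Z[unfolded V_def X_def] ZN])
  qed
  have "672 * W \<ge> 1" using W1 by simp
  thus ?thesis using main by (intro exI[of _ "672 * W"] conjI allI impI)
qed

section \<open>From monomials to polynomials\<close>

lemma poly_split_leading:
  fixes p :: "real poly"
  assumes "degree p \<le> Suc k" "poly p 0 = 0"
  shows "\<exists>q. degree q \<le> k \<and> poly q 0 = 0 \<and> (\<forall>x. poly p x = coeff p (Suc k) * x ^ Suc k + poly q x)"
proof (intro exI conjI allI)
  let ?q = "p - monom (coeff p (Suc k)) (Suc k)"
  show "degree ?q \<le> k"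
    using assms(1) by (intro degree_le) (auto simp: coeff_eq_0)
  show "poly ?q 0 = 0" using assms(2) by (simp add: poly_monom)
  show "poly p x = coeff p (Suc k) * x ^ Suc k + poly ?q x" for x by (simp add: poly_monom)
qed

text \<open>Induction on the degree with \<open>n = n1 * n2\<close>: \<open>n1\<close> handles the
  leading monomials with a tolerance that survives multiplication by \<open>n2 ^ Suc k\<close>, and
  \<open>n2\<close> handles the remainders in the variable \<open>n1 * x\<close>, which have lower
  degree. The exponent grows from \<open>E\<close> to \<open>4 * E + 4\<close>.\<close>

lemma polynomial_recurrence:
  "\<exists>K\<ge>1. \<exists>E\<ge>1. \<forall>d (h::nat \<Rightarrow> real poly) \<delta> N. d \<ge> 1 \<longrightarrow>
     (\<forall>j<d. degree (h j) \<le> k \<and> poly (h j) 0 = 0) \<longrightarrow> 0 < \<delta> \<longrightarrow> \<delta> \<le> 1 / 2 \<longrightarrow> N \<ge> 1 \<longrightarrow>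
     K * (real d * ln (1 / \<delta>)) ^ E \<le> ln (real N) \<longrightarrow>
     (\<exists>n. 1 \<le> n \<and> n \<le> N \<and> (\<forall>j<d. dist_nearest_int (poly (h j) (real n)) \<le> \<delta>))"
proof (induction k)
  case 0
  have main: "\<exists>n. 1 \<le> n \<and> n \<le> N \<and> (\<forall>j<d. dist_nearest_int (poly (h j) (real n)) \<le> \<delta>)"
    if h: "\<forall>j<d. degree (h j) \<le> 0 \<and> poly (h j) 0 = 0" and "0 < \<delta>" "N \<ge> 1"
    for d N and \<delta> :: real and h :: "nat \<Rightarrow> real poly"
  proof -
    have "poly (h j) x = 0" if "j < d" for j x
      using h that by (metis degree_0_id le_zero_eq mult_zero_left poly_0 poly_pCons add_0_right mult_zero_right pCons_0_0)
    moreover have "dist_nearest_int 0 = 0" by (simp add: dist_nearest_int_eq)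
    ultimately show ?thesis using that by (intro exI[of _ 1]) auto
  qed
  show ?case by (rule exI[of _ 1], rule conjI, simp, rule exI[of _ 1], rule conjI, simp, intro allI impI, rule main)
next
  case (Suc k)
  obtain K E where K: "K \<ge> 1" and E: "E \<ge> 1" and IH: "\<forall>d (h::nat \<Rightarrow> real poly) \<delta> N. d \<ge> 1 \<longrightarrow>
     (\<forall>j<d. degree (h j) \<le> k \<and> poly (h j) 0 = 0) \<longrightarrow> 0 < \<delta> \<longrightarrow> \<delta> \<le> 1 / 2 \<longrightarrow> N \<ge> 1 \<longrightarrow>
     K * (real d * ln (1 / \<delta>)) ^ E \<le> ln (real N) \<longrightarrow>
     (\<exists>n. 1 \<le> n \<and> n \<le> N \<and> (\<forall>j<d. dist_nearest_int (poly (h j) (real n)) \<le> \<delta>))"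
    using Suc.IH by (elim exE conjE)
  have Suc_ge_1: "Suc k \<ge> 1" by simp
  obtain K' where K': "K' \<ge> 1" and mono: "\<forall>d (\<alpha>::nat \<Rightarrow> real) \<delta> N. d \<ge> 1 \<longrightarrow> 0 < \<delta> \<longrightarrow> \<delta> \<le> 1 / 2 \<longrightarrow> N \<ge> 1 \<longrightarrow>
     K' * (real d * ln (1 / \<delta>)) ^ 4 \<le> ln (real N) \<longrightarrow>
     (\<exists>n. 1 \<le> n \<and> n \<le> N \<and> (\<forall>j<d. dist_nearest_int (\<alpha> j * real n ^ Suc k) \<le> \<delta>))"
    using monomial_recurrence[OF Suc_ge_1] by (elim exE conjE)
  \<comment> \<open>\<open>A * y ^ (E + 1)\<close> bounds the cost of the finer tolerance
    \<open>\<delta>1\<close>. \<open>K2\<close> collects the exponents of the bounds for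
    \<open>n1\<close> and \<open>n2\<close>; its power of 2 comes from the factor 2 in
    \<open>y\<close>.\<close>
  define A where "A = 1 + 2 * real (Suc k) * K"
  have A1: "A \<ge> 1" using K by (simp add: A_def)
  define K2 where "K2 = (2 * K' * A ^ 4 + 2 * K) * 2 ^ (4 * E + 4)"
  have "2 * K' * A ^ 4 \<ge> 0" using K' A1 by simp
  hence "1 * 1 \<le> K2" unfolding K2_def using K by (intro mult_mono one_le_power) auto
  hence K2: "K2 \<ge> 1" by simp
  have main: "\<exists>n. 1 \<le> n \<and> n \<le> N \<and> (\<forall>j<d. dist_nearest_int (poly (h j) (real n)) \<le> \<delta>)"
    if d: "d \<ge> 1" and h: "\<forall>j<d. degree (h j) \<le> Suc k \<and> poly (h j) 0 = 0" and \<delta>: "0 < \<delta>" "\<delta> \<le> 1 / 2"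
      and N: "N \<ge> 1" and lnN: "K2 * (real d * ln (1 / \<delta>)) ^ (4 * E + 4) \<le> ln (real N)"
    for d N and \<delta> :: real and h :: "nat \<Rightarrow> real poly"
  proof -
    define y where "y = 2 * (real d * ln (1 / \<delta>))"
    have dy: "real d \<le> y" and y1: "1 \<le> y" using dim_le_of_scale[OF d \<delta>] unfolding y_def by auto
    have yE: "1 \<le> K * y ^ E"
      using mult_mono[of 1 K 1 "y ^ E"] K one_le_power[OF y1, of E] by simp
    have half: "real d * ln (1 / (\<delta> / 2)) \<le> y"
    proof -
      have "ln (1 / (\<delta> / 2)) = ln (2 * (1 / \<delta>))" by simp
      also have "\<dots> = ln 2 + ln (1 / \<delta>)" using \<delta> by (intro ln_mult_pos) auto
      also have "\<dots> \<le> 2 * ln (1 / \<delta>)" using \<delta> by (simp add: field_simps)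
      finally have "real d * ln (1 / (\<delta> / 2)) \<le> real d * (2 * ln (1 / \<delta>))" by (intro mult_left_mono) auto
      thus ?thesis by (simp add: y_def)
    qed
    have ln_half: "ln (1 / (\<delta> / 2)) \<ge> 0" using \<delta> by simp
    \<comment> \<open>The range for \<open>n2\<close> depends only on \<open>d\<close> and
      \<open>\<delta>\<close>, so it can be fixed before \<open>n1\<close> is chosen.\<close>
    define M where "M = nat \<lceil>exp (K * y ^ E)\<rceil>"
    have M_ge: "exp (K * y ^ E) \<le> real M" unfolding M_def by linarith
    have M_le: "real M \<le> exp (2 * (K * y ^ E))" unfolding M_def by (rule nat_ceiling_exp_le[OF yE])
    have Mpos: "real M > 0" using M_ge exp_gt_zero[of "K * y ^ E"] by linarith
    have M1: "M \<ge> 1" using Mpos by simp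
    \<comment> \<open>Multiplication by \<open>n2 ^ Suc k \<le> M ^ Suc k\<close> brings this
      tolerance back to at most \<open>\<delta> / 2\<close>.\<close>
    define \<delta>1 where "\<delta>1 = \<delta> / 2 / real M ^ Suc k"
    have \<delta>1: "0 < \<delta>1" "\<delta>1 \<le> 1 / 2"
    proof -
      show "0 < \<delta>1" using \<delta> Mpos by (simp add: \<delta>1_def)
      have "\<delta>1 \<le> \<delta> / 2 / 1" unfolding \<delta>1_def using \<delta> M1
        by (intro divide_left_mono one_le_power) auto
      thus "\<delta>1 \<le> 1 / 2" using \<delta> by simp
    qed
    have ln1: "real d * ln (1 / \<delta>1) \<le> A * y ^ (E + 1)"
    proof -
      have "1 / \<delta>1 = (1 / (\<delta> / 2)) * real M ^ Suc k" by (simp add: \<delta>1_def)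
      hence "ln (1 / \<delta>1) = ln (1 / (\<delta> / 2)) + ln (real M ^ Suc k)"
        using \<delta> Mpos by (simp only: ln_mult_pos zero_less_power zero_less_divide_iff zero_less_one zero_less_numeral simp_thms)
      also have "ln (real M ^ Suc k) = real (Suc k) * ln (real M)" using Mpos by (intro ln_realpow)
      also have "ln (real M) \<le> 2 * (K * y ^ E)"
      proof -
        have "ln (real M) \<le> ln (exp (2 * (K * y ^ E)))" using M_le Mpos by (subst ln_le_cancel_iff) auto
        thus ?thesis by simp
      qed
      finally have "ln (1 / \<delta>1) \<le> ln (1 / (\<delta> / 2)) + real (Suc k) * (2 * (K * y ^ E))" by simp
      hence "real d * ln (1 / \<delta>1) \<le> real d * (ln (1 / (\<delta> / 2)) + real (Suc k) * (2 * (K * y ^ E)))"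
        by (intro mult_left_mono) auto
      also have "\<dots> = real d * ln (1 / (\<delta> / 2)) + real d * (real (Suc k) * (2 * (K * y ^ E)))"
        by (simp only: distrib_left)
      also have "\<dots> \<le> y + y * (real (Suc k) * (2 * (K * y ^ E)))"
        using half dy K y1 by (intro add_mono mult_right_mono) auto
      also have "\<dots> \<le> y ^ (E + 1) + y * (real (Suc k) * (2 * (K * y ^ E)))"
        using self_le_power[of y "E + 1"] y1 by (intro add_right_mono) auto
      also have "\<dots> = A * y ^ (E + 1)" by (simp add: A_def algebra_simps)
      finally show ?thesis .
    qed
    define B where "B = K' * (A * y ^ (E + 1)) ^ 4"
    have B1: "B \<ge> 1"
    proof -
      have "A * y ^ (E + 1) \<ge> 1 * 1" using A1 y1 by (intro mult_mono one_le_power) auto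
      hence "K' * (A * y ^ (E + 1)) ^ 4 \<ge> 1 * 1" using K' by (intro mult_mono one_le_power) auto
      thus ?thesis by (simp add: B_def)
    qed
    define N1 where "N1 = nat \<lceil>exp B\<rceil>"
    have N1_ge: "exp B \<le> real N1" unfolding N1_def by linarith
    have N1_le: "real N1 \<le> exp (2 * B)" unfolding N1_def by (rule nat_ceiling_exp_le[OF B1])
    have N1: "N1 \<ge> 1" using N1_ge exp_gt_zero[of B] by (cases N1) auto
    have "K' * (real d * ln (1 / \<delta>1)) ^ 4 \<le> B"
      unfolding B_def using ln1 K' \<delta>1 by (intro mult_left_mono power_mono) auto
    also have "\<dots> \<le> ln (real N1)" using N1_ge N1 by (subst ln_ge_iff) auto
    finally have pre1: "K' * (real d * ln (1 / \<delta>1)) ^ 4 \<le> ln (real N1)" .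
    obtain n1 where n1: "1 \<le> n1" "n1 \<le> N1"
        "\<forall>j<d. dist_nearest_int (coeff (h j) (Suc k) * real n1 ^ Suc k) \<le> \<delta>1"
      using mono[rule_format, OF d \<delta>1 N1 pre1, of "\<lambda>j. coeff (h j) (Suc k)"] by blast
    have "\<forall>j. \<exists>q. j < d \<longrightarrow> degree q \<le> k \<and> poly q 0 = 0 \<and>
        (\<forall>x. poly (h j) x = coeff (h j) (Suc k) * x ^ Suc k + poly q x)"
      using poly_split_leading h by meson
    then obtain g where g: "\<And>j. j < d \<Longrightarrow> degree (g j) \<le> k" "\<And>j. j < d \<Longrightarrow> poly (g j) 0 = 0"
        "\<And>j x. j < d \<Longrightarrow> poly (h j) x = coeff (h j) (Suc k) * x ^ Suc k + poly (g j) x"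
      by metis
    \<comment> \<open>The substitution of \<open>n1 * x\<close> does not raise the degree and
      preserves the zero constant term.\<close>
    define g' where "g' = (\<lambda>j. pcompose (g j) [:0, real n1:])"
    have g': "\<forall>j<d. degree (g' j) \<le> k \<and> poly (g' j) 0 = 0"
    proof (intro allI impI conjI)
      fix j assume j: "j < d"
      have "degree (g' j) \<le> degree (g j) * degree [:0, real n1:]" unfolding g'_def by (rule degree_pcompose_le)
      also have "\<dots> \<le> k * 1" using g(1)[OF j] by (intro mult_mono) auto
      finally show "degree (g' j) \<le> k" by simp
      show "poly (g' j) 0 = 0" using g(2)[OF j] by (simp add: g'_def poly_pcompose)
    qed
    have "K * (real d * ln (1 / (\<delta> / 2))) ^ E \<le> K * y ^ E"
      using half K ln_half by (intro mult_left_mono power_mono) auto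
    also have "\<dots> \<le> ln (real M)" using M_ge M1 by (subst ln_ge_iff) auto
    finally have pre2: "K * (real d * ln (1 / (\<delta> / 2))) ^ E \<le> ln (real M)" .
    have \<delta>2: "0 < \<delta> / 2" "\<delta> / 2 \<le> 1 / 2" using \<delta> by auto
    obtain n2 where n2: "1 \<le> n2" "n2 \<le> M" "\<forall>j<d. dist_nearest_int (poly (g' j) (real n2)) \<le> \<delta> / 2"
      using IH[rule_format, OF d _ \<delta>2 M1 pre2, of g'] g' by blast
    have "dist_nearest_int (poly (h j) (real (n1 * n2))) \<le> \<delta>" if j: "j < d" for j
    proof -
      define c where "c = coeff (h j) (Suc k) * real n1 ^ Suc k"
      have "poly (h j) (real (n1 * n2)) = real (n2 ^ Suc k) * c + poly (g' j) (real n2)"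
        unfolding g(3)[OF j] g'_def c_def by (simp add: poly_pcompose power_mult_distrib mult_ac)
      hence "dist_nearest_int (poly (h j) (real (n1 * n2))) \<le>
          dist_nearest_int (real (n2 ^ Suc k) * c) + dist_nearest_int (poly (g' j) (real n2))"
        using dist_nearest_int_add by simp
      moreover have "dist_nearest_int (real (n2 ^ Suc k) * c) \<le> \<delta> / 2"
      proof -
        have "dist_nearest_int (real (n2 ^ Suc k) * c) \<le> real (n2 ^ Suc k) * dist_nearest_int c"
          by (rule dist_nearest_int_mult_nat)
        also have "\<dots> \<le> real M ^ Suc k * \<delta>1"
          unfolding of_nat_power c_def using n2 n1 j dist_nearest_int_nonneg by (intro mult_mono power_mono) auto
        also have "\<dots> = \<delta> / 2" using Mpos by (simp add: \<delta>1_def)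
        finally show ?thesis .
      qed
      ultimately show ?thesis using n2(3) j by fastforce
    qed
    moreover have "1 \<le> n1 * n2" using n1 n2 by simp
    moreover have "n1 * n2 \<le> N"
    proof -
      have "real (n1 * n2) \<le> exp (2 * B) * exp (2 * (K * y ^ E))"
        unfolding of_nat_mult using n1 n2 N1_le M_le by (intro mult_mono) auto
      also have "\<dots> = exp (2 * B + 2 * (K * y ^ E))" by (simp add: exp_add)
      also have "\<dots> \<le> exp (K2 * (real d * ln (1 / \<delta>)) ^ (4 * E + 4))"
      proof -
        have "y ^ E \<le> y ^ (4 * E + 4)" using y1 by (intro power_increasing) auto
        hence "2 * B + 2 * (K * y ^ E) \<le> 2 * B + 2 * (K * y ^ (4 * E + 4))" using K by simp
        also have "(A * y ^ (E + 1)) ^ 4 = A ^ 4 * y ^ (4 * E + 4)"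
          by (simp add: power_mult_distrib mult.commute power_add flip: power_mult)
        hence "2 * B + 2 * (K * y ^ (4 * E + 4)) = (2 * K' * A ^ 4 + 2 * K) * y ^ (4 * E + 4)"
          unfolding B_def by (simp add: algebra_simps)
        also have "\<dots> = K2 * (real d * ln (1 / \<delta>)) ^ (4 * E + 4)"
          unfolding y_def K2_def power_mult_distrib[of 2] by (simp only: mult.assoc)
        finally show ?thesis by simp
      qed
      also have "\<dots> \<le> exp (ln (real N))" using lnN by simp
      also have "\<dots> = real N" using N by simp
      finally show ?thesis by (simp only: of_nat_le_iff)
    qed
    ultimately show ?thesis by blast
  qed
  have E2: "1 \<le> 4 * E + 4" by simp
  show ?case
    by (rule exI[of _ K2], rule conjI, rule K2, rule exI[of _ "4 * E + 4"], rule conjI, rule E2,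
        intro allI impI, rule main)
qed

text \<open>The recurrence bound is inverted: \<open>\<delta>\<close> is taken to be the exponential
  on the right with \<open>B = 1\<close>, and \<open>D\<close> is large enough for
  \<open>K * (d * ln (1 / \<delta>)) ^ E \<le> ln N\<close>.\<close>

theorem theorem3:
  fixes k :: nat
  assumes "k \<ge> 1"
  shows "\<exists>D::real. D \<ge> 1 \<and> (\<exists>B::real. B > 0 \<and>
    (\<forall>(d::nat) (h::nat \<Rightarrow> real poly) (N::nat).
       d \<ge> 1 \<longrightarrow> (\<forall>j\<in>{1..d}. degree (h j) \<le> k \<and> poly (h j) 0 = 0) \<longrightarrow> N \<ge> 1 \<longrightarrow>
       (\<exists>n::nat. 1 \<le> n \<and> n \<le> N \<and>
          (\<forall>j\<in>{1..d}. dist_nearest_int (poly (h j) (real n)) \<le>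
             B * exp (- (ln (real N) powr (1 / D)) / (4 ^ k * fact k * D * real d ^ (5 * k)))))))"
proof -
  obtain K E where K: "K \<ge> 1" and E: "E \<ge> 1" and rec: "\<forall>d (h::nat \<Rightarrow> real poly) \<delta> N. d \<ge> 1 \<longrightarrow>
     (\<forall>j<d. degree (h j) \<le> k \<and> poly (h j) 0 = 0) \<longrightarrow> 0 < \<delta> \<longrightarrow> \<delta> \<le> 1 / 2 \<longrightarrow> N \<ge> 1 \<longrightarrow>
     K * (real d * ln (1 / \<delta>)) ^ E \<le> ln (real N) \<longrightarrow>
     (\<exists>n. 1 \<le> n \<and> n \<le> N \<and> (\<forall>j<d. dist_nearest_int (poly (h j) (real n)) \<le> \<delta>))"
    using polynomial_recurrence[of k] by (elim exE conjE)
  \<comment> \<open>\<open>D \<ge> K\<close> makes the denominator \<open>R\<close> at least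
    \<open>4 * K * d\<close>; \<open>D \<ge> E\<close> makes \<open>t ^ E\<close> at most
    \<open>ln N\<close> once \<open>ln N \<ge> 1\<close>.\<close>
  define D where "D = K * real E"
  have DK: "D \<ge> K" unfolding D_def using mult_left_mono[of 1 "real E" K] K E by simp
  have D1: "D \<ge> 1" using DK K by simp
  have main: "\<exists>n::nat. 1 \<le> n \<and> n \<le> N \<and> (\<forall>j\<in>{1..d}. dist_nearest_int (poly (h j) (real n)) \<le>
             1 * exp (- (ln (real N) powr (1 / D)) / (4 ^ k * fact k * D * real d ^ (5 * k))))"
    if d: "d \<ge> 1" and h: "\<forall>j\<in>{1..d}. degree (h j) \<le> k \<and> poly (h j) 0 = 0" and N: "N \<ge> 1"
    for d N and h :: "nat \<Rightarrow> real poly"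
  proof -
    define R where "R = 4 ^ k * fact k * D * real d ^ (5 * k)"
    define t where "t = ln (real N) powr (1 / D)"
    define \<delta> where "\<delta> = exp (- t / R)"
    have four: "(4::real) ^ k \<ge> 4 ^ 1" using assms by (intro power_increasing) auto
    have dpow: "real d \<le> real d ^ (5 * k)" using d assms by (intro self_le_power) auto
    have f4: "4 * 1 \<le> 4 ^ k * (fact k :: real)" using four by (intro mult_mono) (auto simp: fact_ge_1)
    have "4 * 1 * K * real d \<le> R" unfolding R_def
      by (rule mult_mono[OF mult_mono[OF f4 DK] dpow]) (use K D1 in auto)
    hence R_ge: "4 * (K * real d) \<le> R" by simp
    have Kd: "1 \<le> K * real d" using mult_mono[of 1 K 1 "real d"] K d by simp
    have R4: "4 \<le> R" using R_ge Kd by linarith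
    have t0: "t \<ge> 0" unfolding t_def by simp
    have "\<exists>n. 1 \<le> n \<and> n \<le> N \<and> (\<forall>j\<in>{1..d}. dist_nearest_int (poly (h j) (real n)) \<le> \<delta>)"
    \<comment> \<open>For \<open>\<delta> > 1 / 2\<close> every \<open>n\<close> works. Otherwise
      \<open>t / R \<ge> 1 / 2\<close>, which forces \<open>ln N \<ge> 1\<close>, so that powers of
      \<open>ln N\<close> increase with the exponent.\<close>
    proof (cases "\<delta> \<le> 1 / 2")
      case False
      have "dist_nearest_int x \<le> \<delta>" for x using dist_nearest_int_le_half[of x] False by linarith
      thus ?thesis using N by (intro exI[of _ 1]) auto
    next
      case True
      have "1 - t / R \<le> \<delta>" unfolding \<delta>_def using exp_ge_add_one_self[of "- t / R"] by simp
      hence "1 / 2 \<le> t / R" using True by linarith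
      hence "1 \<le> t" using R4 by (simp add: field_simps)
      have l1: "ln (real N) \<ge> 1"
      proof (rule ccontr)
        assume "\<not> ?thesis"
        moreover have "0 \<le> ln (real N)" using N by simp
        ultimately have "t \<le> 1" unfolding t_def using D1 by (intro powr_le1) auto
        hence "t / R \<le> 1 / 4" using R4 by (simp add: field_simps)
        thus False using \<open>1 / 2 \<le> t / R\<close> by linarith
      qed
      have ln\<delta>: "ln (1 / \<delta>) = t / R" unfolding \<delta>_def by (simp add: ln_div)
      have "real d * ln (1 / \<delta>) \<le> t / K"
      proof -
        have "real d * K * t \<le> R * t" using R_ge Kd t0 by (intro mult_right_mono) (auto simp: mult.commute)
        thus ?thesis unfolding ln\<delta> using R4 K by (simp add: field_simps)
      qed
      hence "K * (real d * ln (1 / \<delta>)) ^ E \<le> K * (t / K) ^ E"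
        using K t0 R4 unfolding ln\<delta> by (intro mult_left_mono power_mono) auto
      also have "\<dots> = K / K ^ E * t ^ E" by (simp add: power_divide)
      also have "\<dots> \<le> 1 * t ^ E"
        using t0 K E self_le_power[of K E] by (intro mult_right_mono) (auto simp: divide_le_eq)
      also have "1 * t ^ E = ln (real N) powr (real E / D)"
        unfolding t_def using l1 by (simp add: powr_powr flip: powr_realpow)
      also have "\<dots> \<le> ln (real N) powr 1"
        using l1 K E by (intro powr_mono) (auto simp: D_def divide_le_eq)
      also have "\<dots> = ln (real N)" using l1 by simp
      finally have pre: "K * (real d * ln (1 / \<delta>)) ^ E \<le> ln (real N)" .
      \<comment> \<open>Indices from 1 to \<open>d\<close> are shifted to indices below
        \<open>d\<close>.\<close>
      have h': "\<forall>j<d. degree (h (Suc j)) \<le> k \<and> poly (h (Suc j)) 0 = 0" using h by auto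
      have \<delta>0: "0 < \<delta>" by (simp add: \<delta>_def)
      obtain n where n: "1 \<le> n" "n \<le> N" "\<forall>j<d. dist_nearest_int (poly (h (Suc j)) (real n)) \<le> \<delta>"
        using rec[rule_format, OF d _ \<delta>0 True N pre, of "\<lambda>j. h (Suc j)"] h' by blast
      have "dist_nearest_int (poly (h j) (real n)) \<le> \<delta>" if "j \<in> {1..d}" for j
        using n(3)[rule_format, of "j - 1"] that by auto
      thus ?thesis using n by blast
    qed
    thus ?thesis unfolding \<delta>_def t_def R_def by simp
  qed
  show ?thesis
    by (rule exI[of _ D], rule conjI, rule D1, rule exI[of _ 1], rule conjI, rule zero_less_one,
        intro allI impI, rule main)
qed

end
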